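(* Work in the André/Bruck-Bose setting of the context, with coordinates on the $3$-space $\Pi$ chosen as described there for an element $\omega$ as specified below. For six points $P_1,\dots,P_6$ of $\Pi\setminus\pi_\infty$, write $\mathcal{K}=\{\mathcal{F}(\phi^{-1}(P_i))\mid 1\le i\le 6\}\cup\{\mathcal{F}(P_\infty)\}$, a set of seven planes of $\mathcal{F}(L)\cong\mathrm{PG}(5,q)$. (a) Let $q$ be odd with $q\equiv 1\pmod 3$, let $\omega$ be a root of an irreducible polynomial $X^3+\lambda$ over $\mathbb{F}_q$, and let $a$ be a non-square in $\mathbb{F}_q$ with $a\neq\frac12$. Then for the six points $(1,0,-a,1)$, $(1,0,-a,-1)$, $(1,1,1-a,1)$, $(1,-1,1-a,1)$, $(1,1,1-a,-1)$, $(1,-1,1-a,-1)$, the set $\mathcal{K}$ is a higgledy-piggledy set of $7$ planes in $\mathrm{PG}(5,q)$. (b) Let $q$ be even such that $X^3+X+1$ is irreducible over $\mathbb{F}_q$, let $\omega$ be a root of it, and let $a\in\mathbb{F}_q$ with $\mathrm{Tr}(a)=1$ and $a\neq 1$, where $\mathrm{Tr}$ is the absolute trace $\mathbb{F}_q\to\mathbb{F}_2$. Then for the six points $(1,0,a,1)$, $(1,1,a,1)$, $(a,0,1,1)$, $(a,1,1,1)$, $(1,a,a^2,1)$, $(a^2,a,1,1)$, the set $\mathcal{K}$ is a higgledy-piggledy set of $7$ planes in $\mathrm{PG}(5,q)$.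
   Context: Field reduction: viewing $\mathbb{F}_{q^3}^r$ as $\mathbb{F}_q^{3r}$, points of $\mathrm{PG}(r-1,q^3)$ correspond to planes of $\mathrm{PG}(3r-1,q)$ and lines to $5$-spaces; $\mathcal{F}(X)$ denotes the image. The images of the points of a line form a Desarguesian plane spread of a $5$-space. ABB setting: let $L$ be a line of $\mathrm{PG}(2,q^3)$, $P_\infty\in L$, and $\ell_\infty\neq L$ a line through $P_\infty$; $H_\infty=\mathcal{F}(\ell_\infty)\cong\mathrm{PG}(5,q)$ in $\mathrm{PG}(8,q)$ with its Desarguesian plane spread $\mathcal{D}$. Fix a $6$-space $\mu\supset H_\infty$; for a point $P\notin\ell_\infty$ put $\phi(P)=\mathcal{F}(P)\cap\mu$ (a bijection from the affine points of $L$ onto $\Pi\setminus\pi_\infty$). Let $\pi_\infty=\mathcal{F}(P_\infty)$ and $\Pi=\mathcal{F}(L)\cap\mu$, a $3$-space containing $\pi_\infty$. Regard $H_\infty$ as the subgeometry of $\mathrm{PG}(5,q^3)$ fixed pointwise by a collineation $\sigma$ generating the group fixing it pointwise; $\mathcal{D}$ has a unique indicator line $\nu$ such that spread elements are $\langle P,P^\sigma,P^{\sigma^2}\rangle\cap H_\infty$, $P\in\nu$; the conjugate points defining $\pi_\infty$ are $R,R^\sigma,R^{\sigma^2}$ with $R=\nu\cap\pi_\infty^*$ ($\pi_\infty^*$ the $\mathbb{F}_{q^3}$-extension). Coordinates $(X_0,X_1,X_2,X_3)$ on $\Pi$ are chosen so that $\pi_\infty$ is $X_3=0$ and the three conjugate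 points defining $\pi_\infty$ are $(1,\omega,\omega^2,0)$, $(1,\omega^q,\omega^{2q},0)$, $(1,\omega^{q^2},\omega^{2q^2},0)$. Higgledy-piggledy: a set of planes of $\mathrm{PG}(5,q)$ is in higgledy-piggledy arrangement if the union of their points meets every plane $\kappa$ of $\mathrm{PG}(5,q)$ in a point set spanning $\kappa$.
   Formalization: Higgledy-piggledy is taken to mean that the union of the planes meets every solid (3-space), rather than every plane, of PG(5,q) in a spanning set; with planes the claim fails, since any further plane of the Desarguesian spread misses all seven. *)

theory Defs
  imports
    "HOL-Analysis.Analysis"
    "HOL-Computational_Algebra.Computational_Algebra"
begin

section \<open>Projective subspaces\<close>

(* A projective subspace is identified with the underlying linear subspace. *)
definition proj_sub :: "nat \<Rightarrow> ('a::field^'n) set \<Rightarrow> bool" where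
  "proj_sub d U \<longleftrightarrow> vec.subspace U \<and> vec.dim U = d + 1"

abbreviation "pg_point \<equiv> proj_sub 0"
abbreviation "pg_line \<equiv> proj_sub 1"
abbreviation "pg_plane \<equiv> proj_sub 2"

(* A set of k-subspaces of W = PG(N,q) whose union meets every (N-k)-subspace of W in a
   spanning point set.  For planes of PG(5,q) one has N - k = 3: the test subspaces are the
   solids.  Planes would be too small, as they can miss a plane of PG(5,q) altogether. *)
definition higgledy_piggledy :: "nat \<Rightarrow> nat \<Rightarrow> ('a::field^'n) set \<Rightarrow> ('a^'n) set set \<Rightarrow> bool" where
  "higgledy_piggledy N k W S \<longleftrightarrow>
     k \<le> N \<and> proj_sub N W \<and>
     (\<forall>U\<in>S. proj_sub k U \<and> U \<subseteq> W) \<and>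
     (\<forall>\<kappa>. proj_sub (N - k) \<kappa> \<and> \<kappa> \<subseteq> W \<longrightarrow> vec.span (\<kappa> \<inter> \<Union>S) = \<kappa>)"


section \<open>Field reduction\<close>

definition field_embedding :: "('a::field \<Rightarrow> 'b::field) \<Rightarrow> bool" where
  "field_embedding e \<longleftrightarrow>
     e 1 = 1 \<and> (\<forall>x y. e (x + y) = e x + e y) \<and> (\<forall>x y. e (x * y) = e x * e y)"

(* An identification of the vector space over the big field 'k with a coordinate space over
   the small field 'f.  The field reduction of a subspace X is then the image \<beta> ` X. *)
definition field_reduction :: "('f::field \<Rightarrow> 'k::field) \<Rightarrow> ('k^'r \<Rightarrow> 'f^'m) \<Rightarrow> bool" where
  "field_reduction e \<beta> \<longleftrightarrow>
     bij \<beta> \<and> (\<forall>x y. \<beta> (x + y) = \<beta> x + \<beta> y) \<and> (\<forall>c x. \<beta> (e c *s x) = c *s \<beta> x)"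


section \<open>Subgeometries and conjugate points\<close>

definition lift_vec :: "('a \<Rightarrow> 'b) \<Rightarrow> 'a^'n \<Rightarrow> 'b^'n" where
  "lift_vec e v = (\<chi> i. e (v $ i))"

(* The extension U* of a subspace U to the big field.  It has the same dimension as U, and
   the points ext e P, for P a point of U, form the subgeometry U of U*. *)
definition ext :: "('f::field \<Rightarrow> 'k::field) \<Rightarrow> ('f^'n) set \<Rightarrow> ('k^'n) set" where
  "ext e U = vec.span (lift_vec e ` U)"

(* The intersection of a subspace S over the big field with the subgeometry H, as a subspace
   over the small field. *)
definition subgeometry_part ::
    "('f::field \<Rightarrow> 'k::field) \<Rightarrow> ('f^'n) set \<Rightarrow> ('k^'n) set \<Rightarrow> ('f^'n) set" where
  "subgeometry_part e H S = {v \<in> H. lift_vec e v \<in> S}"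

(* Collineations are taken in the group of semilinear maps; g acts on a subspace X of W by
   X \<mapsto> g ` X. *)
definition collineation :: "('k::field^'n) set \<Rightarrow> ('k^'n \<Rightarrow> 'k^'n) \<Rightarrow> bool" where
  "collineation W g \<longleftrightarrow> bij_betw g W W \<and>
     (\<exists>\<tau>. bij \<tau> \<and> field_embedding \<tau> \<and>
        (\<forall>x\<in>W. \<forall>y\<in>W. g (x + y) = g x + g y) \<and>
        (\<forall>c. \<forall>x\<in>W. g (c *s x) = \<tau> c *s g x))"

definition fixes_subgeometry ::
    "('f::field \<Rightarrow> 'k::field) \<Rightarrow> ('f^'n) set \<Rightarrow> ('k^'n \<Rightarrow> 'k^'n) \<Rightarrow> bool" where
  "fixes_subgeometry e H g \<longleftrightarrow>
     collineation (ext e H) g \<and>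
     (\<forall>P. pg_point P \<and> P \<subseteq> H \<longrightarrow> g ` ext e P = ext e P)"

(* \<sigma> generates the group of collineations of H* that fix H pointwise.  That group is finite,
   so nonnegative powers suffice; equality of collineations is equality on points. *)
definition generates_pointwise_stabiliser ::
    "('f::{field,finite} \<Rightarrow> 'k::{field,finite}) \<Rightarrow> ('f^'n) set \<Rightarrow> ('k^'n \<Rightarrow> 'k^'n) \<Rightarrow> bool" where
  "generates_pointwise_stabiliser e H \<sigma> \<longleftrightarrow>
     fixes_subgeometry e H \<sigma> \<and>
     (\<forall>g. fixes_subgeometry e H g \<longrightarrow>
        (\<exists>n. \<forall>P. pg_point P \<and> P \<subseteq> ext e H \<longrightarrow> g ` P = (\<sigma> ^^ n) ` P))"

definition conjugate_points :: "('k^'n \<Rightarrow> 'k^'n) \<Rightarrow> ('k^'n) set \<Rightarrow> ('k^'n) set set" where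
  "conjugate_points \<sigma> P = {P, \<sigma> ` P, \<sigma> ` \<sigma> ` P}"

definition indicator_line ::
    "('f::field \<Rightarrow> 'k::field) \<Rightarrow> ('f^'n) set \<Rightarrow> ('f^'n) set set \<Rightarrow> ('k^'n \<Rightarrow> 'k^'n) \<Rightarrow>
     ('k^'n) set \<Rightarrow> bool" where
  "indicator_line e H D \<sigma> \<nu> \<longleftrightarrow>
     pg_line \<nu> \<and> \<nu> \<subseteq> ext e H \<and>
     D = {subgeometry_part e H (vec.span (\<Union>(conjugate_points \<sigma> P))) |P. pg_point P \<and> P \<subseteq> \<nu>}"


section \<open>The Andre/Bruck-Bose setting\<close>

definition desarguesian_spread :: "('k::field^'r \<Rightarrow> 'f::field^'m) \<Rightarrow> ('k^'r) set \<Rightarrow> ('f^'m) set set" where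
  "desarguesian_spread \<beta> l = {\<beta> ` P |P. pg_point P \<and> P \<subseteq> l}"

definition abb_setting ::
    "('f::{field,finite} \<Rightarrow> 'k::{field,finite}) \<Rightarrow> ('k^3 \<Rightarrow> 'f^9) \<Rightarrow>
     ('k^3) set \<Rightarrow> ('k^3) set \<Rightarrow> ('k^3) set \<Rightarrow> ('f^9) set \<Rightarrow> bool" where
  "abb_setting e \<beta> L l_inf P_inf \<mu> \<longleftrightarrow>
     CARD('k) = CARD('f) ^ 3 \<and> field_embedding e \<and> field_reduction e \<beta> \<and>
     pg_line L \<and> pg_point P_inf \<and> P_inf \<subseteq> L \<and>
     pg_line l_inf \<and> l_inf \<noteq> L \<and> P_inf \<subseteq> l_inf \<and>
     proj_sub 6 \<mu> \<and> \<beta> ` l_inf \<subseteq> \<mu>"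

definition abb_map :: "('k^3 \<Rightarrow> 'f^9) \<Rightarrow> ('f^9) set \<Rightarrow> ('k^3) set \<Rightarrow> ('f^9) set" where
  "abb_map \<beta> \<mu> P = \<beta> ` P \<inter> \<mu>"

definition affine_points :: "('k::field^3) set \<Rightarrow> ('k^3) set \<Rightarrow> ('k^3) set set" where
  "affine_points L l_inf = {P. pg_point P \<and> P \<subseteq> L \<and> \<not> P \<subseteq> l_inf}"

definition abb_inv ::
    "('k::field^3 \<Rightarrow> 'f^9) \<Rightarrow> ('k^3) set \<Rightarrow> ('k^3) set \<Rightarrow> ('f^9) set \<Rightarrow> ('f^9) set \<Rightarrow> ('k^3) set" where
  "abb_inv \<beta> L l_inf \<mu> = the_inv_into (affine_points L l_inf) (abb_map \<beta> \<mu>)"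

(* The columns of B are the basis of the coordinate system on the solid \<beta> ` L \<inter> \<mu>, so that
   (X0,X1,X2,X3) is the point spanned by B *v (X0,X1,X2,X3).  The components X0,...,X3 have the
   indices 1,...,4.  The same matrix, read over 'k, gives the coordinates on the extension. *)
definition abb_coordinates ::
    "('f::{field,finite} \<Rightarrow> 'k::{field,finite}) \<Rightarrow> ('k^3 \<Rightarrow> 'f^9) \<Rightarrow>
     ('k^3) set \<Rightarrow> ('k^3) set \<Rightarrow> ('f^9) set \<Rightarrow> ('k^9 \<Rightarrow> 'k^9) \<Rightarrow> ('k^9) set \<Rightarrow>
     'k \<Rightarrow> 'f^4^9 \<Rightarrow> bool" where
  "abb_coordinates e \<beta> L P_inf \<mu> \<sigma> \<nu> \<omega> B \<longleftrightarrow>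
     inj ((*v) B) \<and> range ((*v) B) = \<beta> ` L \<inter> \<mu> \<and>
     (*v) B ` {X. X $ 4 = 0} = \<beta> ` P_inf \<and>
     {vec.span {map_matrix e B *v vector [1, \<omega> ^ (CARD('f) ^ i), \<omega> ^ (2 * CARD('f) ^ i), 0]} |i.
        i \<in> {0, 1, 2}}
       = conjugate_points \<sigma> (\<nu> \<inter> ext e (\<beta> ` P_inf))"

definition coord_point :: "'f::field^4^9 \<Rightarrow> 'f list \<Rightarrow> ('f^9) set" where
  "coord_point B xs = vec.span {B *v vector xs}"

(* The set K of planes of \<beta> ` L obtained from a list of coordinate vectors of affine points. *)
definition plane_set ::
    "('k::field^3 \<Rightarrow> 'f::field^9) \<Rightarrow> ('k^3) set \<Rightarrow> ('k^3) set \<Rightarrow> ('k^3) set \<Rightarrow> ('f^9) set \<Rightarrow>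
     'f^4^9 \<Rightarrow> 'f list list \<Rightarrow> ('f^9) set set" where
  "plane_set \<beta> L l_inf P_inf \<mu> B pts =
     {\<beta> ` abb_inv \<beta> L l_inf \<mu> (coord_point B xs) |xs. xs \<in> set pts} \<union> {\<beta> ` P_inf}"

(* The trace of a finite field over its prime field: if the field has p^h elements, then
   h = multiplicity p (p^h). *)
definition absolute_trace :: "'f::{field,finite} \<Rightarrow> 'f" where
  "absolute_trace a = (\<Sum>i<multiplicity CHAR('f) CARD('f). a ^ (CHAR('f) ^ i))"

end

theory Submission
  imports Defs
begin

text \<open>
  If seven spread planes are not higgledy-piggledy, then the points of their union in some solid
  lie in a plane, so the seven corresponding points of \<open>L\<close> lie in an \<open>\<F>\<^sub>q\<close>-linear set of rank 3. The
  affine part of such a set through \<open>P\<^sub>\<infinity>\<close> is contained in a plane of \<open>\<Pi>\<close>, or in a quadric of \<open>\<Pi>\<close>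
  that contains the three conjugate points and an affine line. Quadrics through the conjugate points
  and the six given points reduce to a unique one, \<open>X\<^sub>0 X\<^sub>2 - X\<^sub>1\<^sup>2 + a X\<^sub>3\<^sup>2 = 0\<close> in case (a) and
  \<open>X\<^sub>0 X\<^sub>2 + X\<^sub>1\<^sup>2 + X\<^sub>1 X\<^sub>3 + a X\<^sub>3\<^sup>2 = 0\<close> in case (b). Both are elliptic by the choice of \<open>a\<close>, so they
  contain no line. That the chosen coordinates identify \<open>\<pi>\<^sub>\<infinity>\<close> with \<open>\<F>\<^bsub>q^3\<^esub>\<close> up to scalars and conjugation
  follows because the indicator line is unique up to conjugation.
\<close>

section \<open>Finite fields and the cubic extension\<close>

text \<open>An affine point of \<open>L\<close> is spanned by \<open>g + t *s p\<close> for one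
  \<open>t\<close> in \<open>'k\<close>, so \<Pi> without its plane at infinity becomes the cubic
  field. In the coordinates \<open>t\<close>, \<open>frob t\<close>, \<open>frob (frob t)\<close>
  the conjugate points are the vertices at infinity, and a quadric contains them exactly when no
  conjugate of \<open>t\<close> occurs squared. Seven coefficients remain, which is why six affine
  points can leave a single quadric up to scalars. The coefficients may lie in \<open>'k\<close>, so
  no equation has to be shown to be defined over \<open>'f\<close>. The obstacle is that \<sigma>
  and \<nu> are given abstractly and the conjugate points only as a set. Which conjugate of \<omega>
  the coordinates single out stays unknown, so the algebra is done for an arbitrary conjugate
  \<theta>.\<close>

lemma finite_field_power_card:
  fixes x :: "'a::{field,finite}"
  shows "x ^ CARD('a) = x"
proof (cases "x = 0")
  case False
  have "(\<Prod>y\<in>UNIV - {0}. x * y) = \<Prod>(UNIV - {0 :: 'a})"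
    by (rule prod.reindex_bij_witness[of _ "\<lambda>y. y / x" "\<lambda>y. x * y"]) (use False in auto)
  then have "x ^ (CARD('a) - 1) * \<Prod>(UNIV - {0 :: 'a}) = \<Prod>(UNIV - {0 :: 'a})"
    by (simp add: prod.distrib)
  then have "x ^ (CARD('a) - 1) = 1"
    by (simp add: prod_zero_iff)
  then show ?thesis
    using power_Suc[of x "CARD('a) - 1"] by simp
next
  case True
  then show ?thesis by (simp add: card_gt_0_iff)
qed

text \<open>\<open>(x + 1) ^ q\<close> and \<open>x ^ q + 1\<close> both equal \<open>x + 1\<close>
  at every element, so the inner binomial terms form a polynomial of degree below q with q
  roots.\<close>

lemma of_nat_card_choose_eq_0:
  assumes "0 < i" "i < CARD('a::{field,finite})"
  shows "(of_nat (CARD('a) choose i) :: 'a) = 0"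
proof -
  let ?q = "CARD('a)"
  define P :: "'a poly" where "P = (\<Sum>k\<in>{1..<?q}. monom (of_nat (?q choose k)) k)"
  have q: "?q > 1"
    using assms by linarith
  have "poly P x = 0" for x
  proof -
    have "(x + 1) ^ ?q = (\<Sum>k\<le>?q. of_nat (?q choose k) * x ^ k)"
      by (simp add: binomial_ring)
    also have "{..?q} = insert 0 (insert ?q {1..<?q})"
      using q by auto
    finally have "(x + 1) ^ ?q = 1 + (x ^ ?q + poly P x)"
      using q by (simp add: P_def poly_sum poly_monom)
    then show ?thesis
      unfolding finite_field_power_card by simp
  qed
  moreover have "degree P < ?q"
  proof -
    have "degree P \<le> ?q - 1"
      unfolding P_def by (rule degree_sum_le) (auto intro: order_trans[OF degree_monom_le])
    then show ?thesis using q by linarith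
  qed
  ultimately have "P = 0"
    using card_poly_roots_bound[of P] by (cases "P = 0") auto
  moreover have "coeff P i = of_nat (?q choose i)"
    using assms by (simp add: P_def coeff_sum sum.delta)
  ultimately show ?thesis
    by simp
qed

section \<open>Characteristic two and the absolute trace\<close>

lemma card_power_of_two:
  assumes two: "(2 :: 'a::{field,finite}) = 0"
  shows "\<exists>n. CARD('a) = 2 ^ n"
proof -
  \<comment> \<open>A largest additive subgroup whose order is a power of two is everything: if it
    missed \<open>x\<close>, adjoining the coset of \<open>x\<close> would double it.\<close>
  define S where "S = {H :: 'a set. 0 \<in> H \<and> (\<forall>x\<in>H. \<forall>y\<in>H. x + y \<in> H) \<and> (\<exists>n. card H = 2 ^ n)}"
  have dbl: "x + x = 0" for x :: 'a
    using two by (metis mult_2 mult_zero_left)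
  have "{0} \<in> S"
    by (auto simp: S_def intro: exI[of _ 0])
  then have "Max (card ` S) \<in> card ` S"
    by (intro Max_in) auto
  then obtain H where H: "H \<in> S" "card H = Max (card ` S)"
    by auto
  have max: "card H' \<le> card H" if "H' \<in> S" for H'
    using that by (simp add: H(2))
  have "H = UNIV"
  proof (rule ccontr)
    assume "H \<noteq> UNIV"
    then obtain x where x: "x \<notin> H" by auto
    have cl: "a + b \<in> H" if "a \<in> H" "b \<in> H" for a b
      using H(1) that by (auto simp: S_def)
    have "(+) x ` H \<inter> H = {}"
    proof -
      have "x + h \<notin> H" if "h \<in> H" for h
        using cl[of "x + h" h] that x by (auto simp: add.assoc dbl)
      then show ?thesis by auto
    qed
    then have card: "card (H \<union> (+) x ` H) = 2 * card H"
      by (subst card_Un_disjoint) (auto simp: card_image)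
    have "H \<union> (+) x ` H \<in> S"
    proof -
      have "\<exists>n. card (H \<union> (+) x ` H) = 2 ^ n"
        using H(1) unfolding card S_def by (auto intro: exI[of _ "Suc _"])
      moreover have "a + b \<in> H \<union> (+) x ` H" if "a \<in> H \<union> (+) x ` H" "b \<in> H \<union> (+) x ` H" for a b
      proof -
        have xx: "x + (x + y) = y" for y
          by (simp add: dbl flip: add.assoc)
        have mem: "y \<in> H \<union> (+) x ` H \<longleftrightarrow> y \<in> H \<or> x + y \<in> H" for y
          using xx by (auto simp: image_iff) (metis xx)
        have "x + (a + b) = (x + a) + b" "x + (a + b) = a + (x + b)" "a + b = (x + a) + (x + b)"
          using xx by (simp_all add: ac_simps)
        then show ?thesis
          using that cl[of a b] cl[of "x + a" b] cl[of a "x + b"] cl[of "x + a" "x + b"]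
          unfolding mem by metis
      qed
      moreover have "0 \<in> H"
        using H(1) by (auto simp: S_def)
      ultimately show ?thesis
        by (auto simp: S_def)
    qed
    from max[OF this] card have "card H = 0" by simp
    then show False
      using H(1) by (auto simp: S_def)
  qed
  then show ?thesis
    using H(1) by (auto simp: S_def)
qed

text \<open>For even q the power \<open>(- 1) ^ q\<close> is both 1 and - 1. The converse uses that
  the order is a power of two larger than 1.\<close>

lemma even_card_iff_char_two:
  "even CARD('a::{field,finite}) \<longleftrightarrow> (2 :: 'a) = 0"
proof
  assume "even CARD('a)"
  then have "(1 :: 'a) = - 1"
    using finite_field_power_card[of "- 1 :: 'a"] by simp
  then show "(2 :: 'a) = 0"
    by (metis add.right_inverse one_add_one)
next
  assume "(2 :: 'a) = 0"
  then obtain n where n: "CARD('a) = 2 ^ n"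
    using card_power_of_two by blast
  moreover have "card {0, 1 :: 'a} \<le> CARD('a)"
    by (rule card_mono) auto
  ultimately show "even CARD('a)"
    by (cases n) auto
qed

lemma char_two_eq:
  assumes "(2 :: 'a::{field,finite}) = 0"
  shows "CHAR('a) = 2"
proof -
  have "CHAR('a) dvd 2"
    using assms of_nat_eq_0_iff_char_dvd[where ?'a = 'a, of 2] by simp
  then show ?thesis
    using two_is_prime_nat CHAR_not_1'[where ?'a = 'a] unfolding prime_nat_iff by auto
qed

text \<open>The summands \<open>(z^2 + z) ^ (2 ^ i)\<close> telescope to
  \<open>z ^ (2 ^ n) - z\<close>, which vanishes. An element of trace 1 is therefore not of the form
  \<open>b^2 + b\<close>; the trace condition is used in this form.\<close>

lemma absolute_trace_artin_schreier:
  assumes two: "(2 :: 'f::{field,finite}) = 0"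
  shows "absolute_trace (z\<^sup>2 + z :: 'f) = 0"
proof -
  obtain n where n: "CARD('f) = 2 ^ n"
    using card_power_of_two[OF two] by blast
  have char: "CHAR('f) = 2"
    by (rule char_two_eq[OF two])
  have "(\<Sum>i<m. (z\<^sup>2 + z) ^ (2 ^ i)) = z ^ (2 ^ m) - z" for m
  proof (induction m)
    case (Suc m)
    have "(z\<^sup>2 + z) ^ (2 ^ m) = (z\<^sup>2) ^ (2 ^ m) + z ^ (2 ^ m)"
      by (rule freshmans_dream'[where n = m]) (simp_all add: char)
    moreover have "z ^ (2 ^ m) + z ^ (2 ^ m) = 0"
      using two by (metis mult_2 mult_zero_left)
    ultimately show ?case
      by (simp add: Suc.IH power_mult[symmetric] ring_distribs)
  qed auto
  from this[of n] show ?thesis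
    using finite_field_power_card[of z] by (simp add: absolute_trace_def char n)
qed

section \<open>The relative Frobenius of the cubic extension\<close>

locale cubic_extension =
  fixes e :: "'f::{field,finite} \<Rightarrow> 'k::{field,finite}"
  assumes embedding: "field_embedding e"
    and card_extension: "CARD('k) = CARD('f) ^ 3"
begin

definition frob :: "'k \<Rightarrow> 'k" where
  "frob x = x ^ CARD('f)"

lemma e_1 [simp]: "e 1 = 1" and e_add: "e (x + y) = e x + e y" and e_mult: "e (x * y) = e x * e y"
  using embedding by (auto simp: field_embedding_def)

lemma e_0 [simp]: "e 0 = 0"
  using e_add[of 0 0] by (metis add_cancel_left_left add_0)

lemma e_minus: "e (- x) = - e x"
  using e_add[of x "- x"] by (simp add: eq_neg_iff_add_eq_0 add.commute)

lemma e_diff: "e (x - y) = e x - e y"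
  using e_add[of x "- y"] by (simp add: e_minus)

lemma e_eq_0_iff [simp]: "e x = 0 \<longleftrightarrow> x = 0"
proof
  assume "e x = 0"
  show "x = 0"
  proof (rule ccontr)
    assume "x \<noteq> 0"
    then have "e x * e (inverse x) = 1" by (simp flip: e_mult)
    then show False using \<open>e x = 0\<close> by simp
  qed
qed simp

lemma e_eq_iff [simp]: "e x = e y \<longleftrightarrow> x = y"
  using e_eq_0_iff[of "x - y"] by (simp add: e_diff)

lemma e_power: "e (x ^ n) = e x ^ n"
  by (induction n) (simp_all add: e_mult)

lemma e_of_nat [simp]: "e (of_nat n) = of_nat n"
  by (induction n) (simp_all add: e_add)

lemma e_numeral [simp]: "e (numeral n) = numeral n"
  by (metis e_of_nat of_nat_numeral)

lemma card_base_gt_1: "CARD('f) > 1"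
proof -
  have "card {0, 1 :: 'f} \<le> CARD('f)"
    by (rule card_mono) auto
  then show ?thesis by simp
qed

lemma frob_add: "frob (x + y) = frob x + frob y"
proof -
  let ?q = "CARD('f)"
  have 0: "of_nat (?q choose k) = (0 :: 'k)" if "k \<in> {1..<?q}" for k
    using of_nat_card_choose_eq_0[of k, where ?'a = 'f] that
    by (metis One_nat_def Suc_le_lessD atLeastLessThan_iff e_0 e_of_nat)
  have "(x + y) ^ ?q = (\<Sum>k\<le>?q. of_nat (?q choose k) * x ^ k * y ^ (?q - k))"
    by (rule binomial_ring)
  also have "\<dots> = (\<Sum>k\<in>{0, ?q}. of_nat (?q choose k) * x ^ k * y ^ (?q - k))"
    by (rule sum.mono_neutral_right) (auto intro!: 0)
  finally show ?thesis
    using card_base_gt_1 by (simp add: frob_def add.commute)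
qed

lemma frob_0 [simp]: "frob 0 = 0" and frob_1 [simp]: "frob 1 = 1"
  by (simp_all add: frob_def)

lemma frob_mult: "frob (x * y) = frob x * frob y"
  by (simp add: frob_def power_mult_distrib)

lemma frob_minus: "frob (- x) = - frob x"
  using frob_add[of x "- x"] by (simp add: eq_neg_iff_add_eq_0 add.commute)

lemma frob_diff: "frob (x - y) = frob x - frob y"
  using frob_add[of x "- y"] by (simp add: frob_minus)

lemma frob_power: "frob (x ^ n) = frob x ^ n"
  by (simp add: frob_def power_mult[symmetric] mult.commute)

lemma frob_divide: "frob (x / y) = frob x / frob y"
  by (simp add: frob_def power_divide)

lemma frob_e [simp]: "frob (e x) = e x"
  by (simp add: frob_def finite_field_power_card flip: e_power)

lemma frob_frob_frob [simp]: "frob (frob (frob x)) = x"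
proof -
  have "frob (frob (frob x)) = x ^ CARD('k)"
    by (simp add: frob_def card_extension power3_eq_cube power_mult)
  then show ?thesis by (simp add: finite_field_power_card)
qed

lemma frob_eq_iff [simp]: "frob x = frob y \<longleftrightarrow> x = y"
  by (metis frob_frob_frob)

lemma frob_eq_0_iff [simp]: "frob x = 0 \<longleftrightarrow> x = 0"
  by (simp add: frob_def)

text \<open>\<open>X ^ q - X\<close> has at most q roots, and the image of \<open>e\<close> already
  supplies q of them.\<close>

lemma frob_fixed_iff: "frob x = x \<longleftrightarrow> x \<in> range e"
proof -
  define P :: "'k poly" where "P = monom 1 (CARD('f)) - monom 1 1"
  have "coeff P (CARD('f)) = 1"
    using card_base_gt_1 by (simp add: P_def)
  then have "P \<noteq> 0" by auto
  have "degree P \<le> CARD('f)"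
    unfolding P_def using card_base_gt_1
    by (intro degree_diff_le) (auto intro: order_trans[OF degree_monom_le])
  have roots: "{x. poly P x = 0} = {x. frob x = x}"
    by (auto simp: P_def poly_monom frob_def)
  have "range e = {x. frob x = x}"
  proof (rule card_subset_eq)
    show "card (range e) = card {x. frob x = x}"
    proof (rule antisym)
      show "card (range e) \<le> card {x. frob x = x}"
        by (rule card_mono) auto
      have "card (range e) = CARD('f)"
        by (rule card_image) (simp add: inj_on_def)
      then show "card {x. frob x = x} \<le> card (range e)"
        using card_poly_roots_bound[OF \<open>P \<noteq> 0\<close>] \<open>degree P \<le> _\<close> by (simp add: roots)
    qed
  qed auto
  then show ?thesis by auto
qed

lemma exists_not_frob_fixed: "\<exists>x. frob x \<noteq> x"
proof (rule ccontr)
  assume "\<not> ?thesis"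
  then have "range e = UNIV"
    by (auto simp: frob_fixed_iff[symmetric])
  then have "CARD('k) \<le> CARD('f)"
    by (metis card_image_le finite_class.finite_UNIV)
  moreover have "CARD('f) ^ 1 < CARD('f) ^ 3"
    using card_base_gt_1 by (intro power_strict_increasing) auto
  ultimately show False by (simp add: card_extension)
qed

end

section \<open>Quadrics through conjugate points\<close>

lemma det3_eq_0:
  fixes a b c :: "'a::field"
  assumes eq: "a * x0 + b * y0 + c * z0 = 0" "a * x1 + b * y1 + c * z1 = 0" "a * x2 + b * y2 + c * z2 = 0"
    and nz: "a \<noteq> 0 \<or> b \<noteq> 0 \<or> c \<noteq> 0"
  shows "x0 * (y1 * z2 - y2 * z1) - x1 * (y0 * z2 - y2 * z0) + x2 * (y0 * z1 - y1 * z0) = 0"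
    (is "?D = 0")
proof -
  have "a * ?D = 0" "b * ?D = 0" "c * ?D = 0"
    using eq by algebra+
  then show ?thesis using nz by auto
qed

text \<open>Weighting the equations with the coefficients of \<open>(T - y) * (T - z)\<close>
  isolates \<open>a\<close>, and similarly for \<open>b\<close> and \<open>c\<close>. This recovers
  the coefficients of a quadric from their sums weighted by powers of the conjugate roots.\<close>

lemma vandermonde3_eq_0:
  fixes x y z :: "'a::field"
  assumes "a + b + c = 0" "a * x + b * y + c * z = 0" "a * x\<^sup>2 + b * y\<^sup>2 + c * z\<^sup>2 = 0"
    and "x \<noteq> y" "x \<noteq> z" "y \<noteq> z"
  shows "a = 0 \<and> b = 0 \<and> c = 0"
proof -
  have "a * ((x - y) * (x - z)) = 0" "b * ((y - x) * (y - z)) = 0" "c * ((z - x) * (z - y)) = 0"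
    using assms(1-3) by algebra+
  then show ?thesis using assms(4-6) by auto
qed

section \<open>Quadrics in conjugate coordinates and Moore determinants\<close>

context cubic_extension
begin

text \<open>The seven-parameter family of quadrics through the conjugate points; \<open>c0\<close>,
  \<open>c1\<close>, \<open>c2\<close> describe the conic cut out at infinity.\<close>

definition quad :: "'k \<Rightarrow> 'k \<Rightarrow> 'k \<Rightarrow> 'k \<Rightarrow> 'k \<Rightarrow> 'k \<Rightarrow> 'k \<Rightarrow> 'k \<Rightarrow> 'k" where
  "quad c0 c1 c2 l0 l1 l2 d t =
     c0 * frob t * frob (frob t) + c1 * t * frob (frob t) + c2 * t * frob t
     + l0 * t + l1 * frob t + l2 * frob (frob t) + d"

text \<open>The branches match the two shapes of a rank 3 linear set. If the part at infinity
  vanishes, the equation is that of a plane and must be trivial on \<open>T\<close>; otherwise the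
  zero set may contain no affine line over \<open>'f\<close>, which is why \<open>s\<close> ranges
  over \<open>'f\<close>.\<close>

definition only_lineless_quadrics :: "'k set \<Rightarrow> bool" where
  "only_lineless_quadrics T \<longleftrightarrow>
     (\<forall>c0 c1 c2 l0 l1 l2 d. (\<forall>t\<in>T. quad c0 c1 c2 l0 l1 l2 d t = 0) \<longrightarrow>
        (if c0 = 0 \<and> c1 = 0 \<and> c2 = 0 then l0 = 0 \<and> l1 = 0 \<and> l2 = 0
         else \<forall>t v. v \<noteq> 0 \<longrightarrow> (\<exists>s. quad c0 c1 c2 l0 l1 l2 d (t + e s * v) \<noteq> 0)))"

text \<open>The Moore determinant, built from three elements and their conjugates.\<close>

definition conj_det :: "'k \<Rightarrow> 'k \<Rightarrow> 'k \<Rightarrow> 'k" where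
  "conj_det x y z =
     x * (frob y * frob (frob z) - frob (frob y) * frob z)
     - frob x * (y * frob (frob z) - frob (frob y) * z)
     + frob (frob x) * (y * frob z - frob y * z)"

text \<open>\<open>frob\<close> fixes the image of \<open>e\<close>, so a dependence over
  \<open>'f\<close> passes to the conjugates with the same coefficients.\<close>

lemma conj_det_eq_0:
  assumes "e a * x + e b * y + e c * z = 0" and "a \<noteq> 0 \<or> b \<noteq> 0 \<or> c \<noteq> 0"
  shows "conj_det x y z = 0"
  unfolding conj_det_def
proof (rule det3_eq_0)
  show "e a * x + e b * y + e c * z = 0"
    by fact
  then have "frob (e a * x + e b * y + e c * z) = 0"
    by simp
  then show f: "e a * frob x + e b * frob y + e c * frob z = 0"
    by (simp add: frob_add frob_mult)
  then have "frob (e a * frob x + e b * frob y + e c * frob z) = 0"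
    by simp
  then show "e a * frob (frob x) + e b * frob (frob y) + e c * frob (frob z) = 0"
    by (simp add: frob_add frob_mult)
qed (use assms(2) in auto)

text \<open>
  An \<open>\<F>\<^sub>q\<close>-linear set of rank 3 through the point at infinity is either an affine plane, or the
  affine part of a quadric that contains an affine line. In both cases it is cut out by a vanishing
  determinant of conjugates.
\<close>

lemma only_lineless_quadrics_imp_not_linear_set:
  assumes T: "only_lineless_quadrics T"
    and u: "u \<noteq> 0" and y: "y \<noteq> 0"
    and indep: "\<And>b c. w = e c * y \<Longrightarrow> g - e c * y * r \<noteq> e b * u"
    and cover: "\<And>t. t \<in> T \<Longrightarrow> \<exists>a b c. (a \<noteq> 0 \<or> c \<noteq> 0) \<and>
                  e a * (y * (t - r)) + e c * (w * t - g) = e b * u"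
  shows False
proof -
  \<comment> \<open>Coefficients of the Moore determinant of \<open>y * (t - r)\<close>,
    \<open>w * t - g\<close> and \<open>u\<close>. Each row is affine in a single conjugate of
    \<open>t\<close> and the column of \<open>u\<close> is constant, so neither squares nor a cubic
    term arise.\<close>
  define c0 where "c0 = (frob y * frob (frob w) - frob w * frob (frob y)) * u"
  define c1 where "c1 = (w * frob (frob y) - y * frob (frob w)) * frob u"
  define c2 where "c2 = (y * frob w - w * frob y) * frob (frob u)"
  define h where "h = y * r"
  define l0 where "l0 = y * (frob (frob g) * frob u - frob g * frob (frob u))
                        + w * (frob h * frob (frob u) - frob (frob h) * frob u)"
  define l1 where "l1 = frob y * (g * frob (frob u) - frob (frob g) * u)
                        + frob w * (frob (frob h) * u - h * frob (frob u))"
  define l2 where "l2 = frob (frob y) * (frob g * u - g * frob u)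
                        + frob (frob w) * (h * frob u - frob h * u)"
  define d where "d = conj_det h g u"
  have expand: "conj_det (y * (t - r)) (w * t - g) u = quad c0 c1 c2 l0 l1 l2 d t" for t
    unfolding conj_det_def quad_def c0_def c1_def c2_def l0_def l1_def l2_def d_def h_def
    by (simp add: frob_mult frob_diff) algebra
  have zero: "quad c0 c1 c2 l0 l1 l2 d t = 0"
    if "e a * (y * (t - r)) + e c * (w * t - g) = e b * u" "a \<noteq> 0 \<or> c \<noteq> 0" for t a b c
    unfolding expand[symmetric]
    by (rule conj_det_eq_0[of a _ c _ "- b"]) (use that in \<open>auto simp: e_minus\<close>)
  have van: "\<forall>t\<in>T. quad c0 c1 c2 l0 l1 l2 d t = 0"
    using cover zero by blast
  note T' = T[unfolded only_lineless_quadrics_def, rule_format, of c0 c1 c2 l0 l1 l2 d]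
  show False
  proof (cases "c0 = 0 \<and> c1 = 0 \<and> c2 = 0")
    case False
    \<comment> \<open>The line through \<open>r\<close> with direction \<open>u / y\<close> comes
      from the first two generators alone: coefficients \<open>a = 1\<close>, \<open>b = s\<close>
      and \<open>c = 0\<close>.\<close>
    have "u / y \<noteq> 0"
      using u y by simp
    then obtain s where "quad c0 c1 c2 l0 l1 l2 d (r + e s * (u / y)) \<noteq> 0"
      using T' van unfolding if_not_P[OF False] by blast
    moreover have "e 1 * (y * (r + e s * (u / y) - r)) + e 0 * (w * (r + e s * (u / y)) - g) = e s * u"
      using y by simp
    ultimately show False
      using zero by (metis zero_neq_one)
  next
    case True
    then have l0: "l0 = 0"
      using T' van unfolding if_P[OF True] by blast
    have "frob (w / y) = w / y"
      using True u y by (auto simp: c2_def frob_divide field_simps)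
    then obtain c where "w / y = e c"
      by (auto simp: frob_fixed_iff)
    then have w: "w = e c * y"
      using y by (simp add: field_simps)
    \<comment> \<open>Subtracting \<open>c\<close> times the first generator from the third leaves a
      vector over the point at infinity with coefficient \<open>k\<close>. Vanishing of
      \<open>l0\<close> puts \<open>k / u\<close> into the image of \<open>e\<close>, which makes
      the generators dependent.\<close>
    define k where "k = g - e c * h"
    have "l0 = y * (frob (frob k) * frob u - frob k * frob (frob u))"
      unfolding l0_def k_def w by (simp add: frob_mult frob_diff) algebra
    then have "frob (frob (k / u)) = frob (k / u)"
      using l0 u y by (simp add: frob_divide field_simps)
    then obtain b where "k / u = e b"
      by (metis frob_eq_iff frob_fixed_iff rangeE)
    then have "g - e c * y * r = e b * u"
      using u by (simp add: k_def h_def field_simps)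
    then show False
      using indep[OF w] by blast
  qed
qed

end

section \<open>Elimination: the quadrics through the six points\<close>

lemma conjugates_cubic_sum:
  fixes x y z :: "'a::field"
  assumes "x ^ 3 + b * x + c = 0" "y ^ 3 + b * y + c = 0" "z ^ 3 + b * z + c = 0"
    and "x \<noteq> y" "x \<noteq> z" "y \<noteq> z"
  shows "x + y + z = 0" and "y * z = x\<^sup>2 + b"
proof -
  have "(x - y) * (x\<^sup>2 + x * y + y\<^sup>2 + b) = 0" "(x - z) * (x\<^sup>2 + x * z + z\<^sup>2 + b) = 0"
    using assms(1-3) by algebra+
  then have q: "x\<^sup>2 + x * y + y\<^sup>2 + b = 0" "x\<^sup>2 + x * z + z\<^sup>2 + b = 0"
    using assms(4-5) by auto
  then have "(y - z) * (x + y + z) = 0"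
    by algebra
  then show s: "x + y + z = 0"
    using assms(6) by auto
  show "y * z = x\<^sup>2 + b"
    using q s by algebra
qed

lemma char_two_minus:
  assumes "(2 :: 'a::ring_1) = 0"
  shows "- x = (x :: 'a)" and "x - y = x + (y :: 'a)"
proof -
  have m: "- x = x" for x :: 'a
    using assms by (metis add_eq_0_iff mult_2 mult_zero_left)
  show "- x = x"
    by (rule m)
  show "x - y = x + y"
    using m[of y] by simp
qed

text \<open>A conjugate point \<open>(1, o, o^2)\<close> has \<open>o ^ 3 = - c\<close>, so the
  conics at infinity through these points form the net spanned by \<open>x * z - y^2\<close>,
  \<open>y * z + c * x^2\<close> and \<open>z^2 + c * x * y\<close>. The factor \<open>r\<close> is
  the sign of the last coordinate: negating an affine parameter changes only the linear part. The
  conditions on \<open>a\<close> eliminate the last two members of the net.\<close>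

lemma quadric_pencil_odd:
  fixes o0 o1 o2 :: "'k::field"
  assumes roots: "o0 ^ 3 + c = 0" "o1 ^ 3 + c = 0" "o2 ^ 3 + c = 0"
    and dist: "o0 \<noteq> o1" "o0 \<noteq> o2" "o1 \<noteq> o2"
    and two: "(2 :: 'k) \<noteq> 0" and a: "a \<noteq> 1" "2 * a \<noteq> 1"
    and Q_def: "\<And>r x y z. Q r x y z =
      c0 * (z - (o0 + o2) * y + o0 * o2 * x) * (z - (o0 + o1) * y + o0 * o1 * x)
      + c1 * (z - (o1 + o2) * y + o1 * o2 * x) * (z - (o0 + o1) * y + o0 * o1 * x)
      + c2 * (z - (o1 + o2) * y + o1 * o2 * x) * (z - (o0 + o2) * y + o0 * o2 * x)
      + r * (l0 * (z - (o1 + o2) * y + o1 * o2 * x) + l1 * (z - (o0 + o2) * y + o0 * o2 * x)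
             + l2 * (z - (o0 + o1) * y + o0 * o1 * x)) + d"
    and zero: "Q 1 1 0 (- a) = 0" "Q (- 1) 1 0 (- a) = 0" "Q 1 1 1 (1 - a) = 0" "Q 1 1 (- 1) (1 - a) = 0"
       "Q (- 1) 1 1 (1 - a) = 0" "Q (- 1) 1 (- 1) (1 - a) = 0"
  shows "l0 = 0 \<and> l1 = 0 \<and> l2 = 0 \<and>
     (\<exists>A. (A = 0 \<longrightarrow> c0 = 0 \<and> c1 = 0 \<and> c2 = 0) \<and> (\<forall>x y z. Q 1 x y z = A * (x * z - y\<^sup>2 + a)))"
proof -
  have s: "o0 + o1 + o2 = 0" and m: "o1 * o2 = o0\<^sup>2" "o0 * o2 = o1\<^sup>2" "o0 * o1 = o2\<^sup>2"
    using conjugates_cubic_sum[of o0 0 c o1 o2] conjugates_cubic_sum[of o1 0 c o0 o2]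
      conjugates_cubic_sum[of o2 0 c o0 o1] roots dist by auto
  have lin: "o1 + o2 = - o0" "o0 + o2 = - o1" "o0 + o1 = - o2"
    using s by algebra+
  define A B C where "A = - (c0 * o0\<^sup>2 + c1 * o1\<^sup>2 + c2 * o2\<^sup>2)"
    and "B = - (c0 * o0 + c1 * o1 + c2 * o2)" and "C = c0 + c1 + c2"
  define m0 m1 m2 where "m0 = l0 * o0\<^sup>2 + l1 * o1\<^sup>2 + l2 * o2\<^sup>2"
    and "m1 = l0 * o0 + l1 * o1 + l2 * o2" and "m2 = l0 + l1 + l2"
  \<comment> \<open>Each linear form vanishes at two of the three conjugate points, so the product
    of two passes through all three and lies in the net.\<close>
  have prod: "(z - (v + w) * y + v * w * x) * (z - (u + w) * y + u * w * x)
      = (z\<^sup>2 + c * x * y) - w * (y * z + c * x\<^sup>2) - w\<^sup>2 * (x * z - y\<^sup>2)"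
    if "u + v + w = 0" "v * w = u\<^sup>2" "u * w = v\<^sup>2" "u * v = w\<^sup>2" "w ^ 3 + c = 0" for u v w x y z
    using that by algebra
  have p0: "(z - (o0 + o2) * y + o0 * o2 * x) * (z - (o0 + o1) * y + o0 * o1 * x)
      = (z\<^sup>2 + c * x * y) - o0 * (y * z + c * x\<^sup>2) - o0\<^sup>2 * (x * z - y\<^sup>2)" for x y z
    using prod[of o1 o2 o0] s m roots by (simp add: ac_simps)
  have p1: "(z - (o1 + o2) * y + o1 * o2 * x) * (z - (o0 + o1) * y + o0 * o1 * x)
      = (z\<^sup>2 + c * x * y) - o1 * (y * z + c * x\<^sup>2) - o1\<^sup>2 * (x * z - y\<^sup>2)" for x y z
    using prod[of o0 o2 o1] s m roots by (simp add: ac_simps)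
  have p2: "(z - (o1 + o2) * y + o1 * o2 * x) * (z - (o0 + o2) * y + o0 * o2 * x)
      = (z\<^sup>2 + c * x * y) - o2 * (y * z + c * x\<^sup>2) - o2\<^sup>2 * (x * z - y\<^sup>2)" for x y z
    using prod[of o0 o1 o2] s m roots by (simp add: ac_simps)
  have Q: "Q r x y z = A * (x * z - y\<^sup>2) + B * (y * z + c * x\<^sup>2) + C * (z\<^sup>2 + c * x * y)
      + r * (m0 * x + m1 * y + m2 * z) + d" for r x y z
    unfolding Q_def mult.assoc[of c0] mult.assoc[of c1] mult.assoc[of c2] p0 p1 p2
    unfolding lin m A_def B_def C_def m0_def m1_def m2_def by (simp add: algebra_simps)
  note zero' = zero[unfolded Q, simplified]
  \<comment> \<open>The values at \<open>r = 1\<close> and \<open>r = - 1\<close> subtract to the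
    linear part, in which the sign of \<open>y\<close> isolates \<open>m1\<close>.\<close>
  have "2 * (2 * m1) = 0"
    using zero'(3-6) by algebra
  moreover have "2 * (m0 - a * m2) = 0"
    using zero'(1,2) by algebra
  moreover have "2 * (2 * (m0 + (1 - a) * m2)) = 0"
    using zero'(3-6) by algebra
  ultimately have "m1 = 0" "m0 = a * m2" "m0 + (1 - a) * m2 = 0"
    using two unfolding mult_eq_0_iff by auto
  then have m_0: "m0 = 0" "m1 = 0" "m2 = 0"
    by (simp_all add: algebra_simps)
  then have l: "l0 = 0 \<and> l1 = 0 \<and> l2 = 0"
    using vandermonde3_eq_0[of l0 l1 l2 o0 o1 o2] dist unfolding m0_def m1_def m2_def by auto
  have "2 * (B * (1 - a) + C * c) = 0"
    using zero'(3,4) unfolding m_0 by algebra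
  \<comment> \<open>The factor of \<open>C\<close> arises as \<open>(1 - a)^2 - a^2\<close>, the
    difference of \<open>z^2\<close> between the two kinds of points.\<close>
  moreover have "2 * (C * (1 - 2 * a)) = 0"
    using zero'(1,3,4) unfolding m_0 by algebra
  ultimately have "C = 0" "B = 0"
    using a two unfolding mult_eq_0_iff by auto
  moreover from this have "d = a * A"
    using zero'(1) unfolding m_0 by algebra
  ultimately have "Q 1 x y z = A * (x * z - y\<^sup>2 + a)" for x y z
    unfolding Q m_0 by algebra
  moreover have "c0 = 0 \<and> c1 = 0 \<and> c2 = 0" if "A = 0"
    using vandermonde3_eq_0[of c0 c1 c2 o0 o1 o2] dist \<open>B = 0\<close> \<open>C = 0\<close> that
    unfolding A_def B_def C_def neg_equal_0_iff_equal by auto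
  ultimately show ?thesis
    using l by blast
qed

text \<open>Now \<open>o ^ 3 = o + 1\<close> gives the net of \<open>x * z + y^2\<close>,
  \<open>y * z + x * y + x^2\<close> and \<open>z^2 + x * z + x * y\<close>. Exchanging
  \<open>x\<close> and \<open>z\<close> pairs the six points, and the sum over a pair removes
  \<open>A\<close>. The identities hold in every commutative ring: what cancels in characteristic
  two is collected in an explicit multiple of 2.\<close>

lemma quadric_pencil_even:
  fixes o0 o1 o2 :: "'k::field"
  assumes roots: "o0 ^ 3 + o0 + 1 = 0" "o1 ^ 3 + o1 + 1 = 0" "o2 ^ 3 + o2 + 1 = 0"
    and dist: "o0 \<noteq> o1" "o0 \<noteq> o2" "o1 \<noteq> o2"
    and two: "(2 :: 'k) = 0" and a: "a \<noteq> 0" "a \<noteq> 1"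
    and Q_def: "\<And>x y z. Q x y z =
      c0 * (z - (o0 + o2) * y + o0 * o2 * x) * (z - (o0 + o1) * y + o0 * o1 * x)
      + c1 * (z - (o1 + o2) * y + o1 * o2 * x) * (z - (o0 + o1) * y + o0 * o1 * x)
      + c2 * (z - (o1 + o2) * y + o1 * o2 * x) * (z - (o0 + o2) * y + o0 * o2 * x)
      + (l0 * (z - (o1 + o2) * y + o1 * o2 * x) + l1 * (z - (o0 + o2) * y + o0 * o2 * x)
             + l2 * (z - (o0 + o1) * y + o0 * o1 * x)) + d"
    and zero: "Q 1 0 a = 0" "Q 1 1 a = 0" "Q a 0 1 = 0" "Q a 1 1 = 0" "Q 1 a (a\<^sup>2) = 0" "Q (a\<^sup>2) a 1 = 0"
  shows "\<exists>A. (A = 0 \<longleftrightarrow> c0 = 0 \<and> c1 = 0 \<and> c2 = 0) \<and> (A = 0 \<longrightarrow> l0 = 0 \<and> l1 = 0 \<and> l2 = 0) \<and>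
             (\<forall>x y z. Q x y z = A * (x * z + y\<^sup>2 + y + a))"
proof -
  have s: "o0 + o1 + o2 = 0" and m: "o1 * o2 = o0\<^sup>2 + 1" "o0 * o2 = o1\<^sup>2 + 1" "o0 * o1 = o2\<^sup>2 + 1"
    using conjugates_cubic_sum[of o0 1 1 o1 o2] conjugates_cubic_sum[of o1 1 1 o0 o2]
      conjugates_cubic_sum[of o2 1 1 o0 o1] roots dist by auto
  note minus = char_two_minus[OF two]
  have "o1 + o2 = - o0" "o0 + o2 = - o1" "o0 + o1 = - o2"
    using s by algebra+
  then have lin: "o1 + o2 = o0" "o0 + o2 = o1" "o0 + o1 = o2"
    unfolding minus .
  define A B C where "A = c0 * (1 + o0\<^sup>2) + c1 * (1 + o1\<^sup>2) + c2 * (1 + o2\<^sup>2)"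
    and "B = c0 * o0 + c1 * o1 + c2 * o2" and "C = c0 + c1 + c2"
  define m0 m1 m2 where "m0 = l0 * (1 + o0\<^sup>2) + l1 * (1 + o1\<^sup>2) + l2 * (1 + o2\<^sup>2)"
    and "m1 = l0 * o0 + l1 * o1 + l2 * o2" and "m2 = l0 + l1 + l2"
  have prod: "(z - (v + w) * y + v * w * x) * (z - (u + w) * y + u * w * x)
      = (z\<^sup>2 + x * z + x * y) + w * (y * z + x * y + x\<^sup>2) + (1 + w\<^sup>2) * (x * z + y\<^sup>2)"
    if "u + v + w = 0" "v * w = u\<^sup>2 + 1" "u * w = v\<^sup>2 + 1" "u * v = w\<^sup>2 + 1" "w ^ 3 + w + 1 = 0"
    for u v w x y z :: 'k
  proof -
    have "(z - (v + w) * y + v * w * x) * (z - (u + w) * y + u * w * x)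
        + 2 * (w * y * z + (1 + w\<^sup>2) * x * z + w * x * y + w * x\<^sup>2)
      = (z\<^sup>2 + x * z + x * y) + w * (y * z + x * y + x\<^sup>2) + (1 + w\<^sup>2) * (x * z + y\<^sup>2)"
      using that by algebra
    then show ?thesis by (simp add: two)
  qed
  have p0: "(z - (o0 + o2) * y + o0 * o2 * x) * (z - (o0 + o1) * y + o0 * o1 * x)
      = (z\<^sup>2 + x * z + x * y) + o0 * (y * z + x * y + x\<^sup>2) + (1 + o0\<^sup>2) * (x * z + y\<^sup>2)" for x y z
    using prod[of o1 o2 o0] s m roots by (simp add: ac_simps)
  have p1: "(z - (o1 + o2) * y + o1 * o2 * x) * (z - (o0 + o1) * y + o0 * o1 * x)
      = (z\<^sup>2 + x * z + x * y) + o1 * (y * z + x * y + x\<^sup>2) + (1 + o1\<^sup>2) * (x * z + y\<^sup>2)" for x y z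
    using prod[of o0 o2 o1] s m roots by (simp add: ac_simps)
  have p2: "(z - (o1 + o2) * y + o1 * o2 * x) * (z - (o0 + o2) * y + o0 * o2 * x)
      = (z\<^sup>2 + x * z + x * y) + o2 * (y * z + x * y + x\<^sup>2) + (1 + o2\<^sup>2) * (x * z + y\<^sup>2)" for x y z
    using prod[of o0 o1 o2] s m roots by (simp add: ac_simps)
  have Q: "Q x y z = A * (x * z + y\<^sup>2) + B * (y * z + x * y + x\<^sup>2) + C * (z\<^sup>2 + x * z + x * y)
      + (m0 * x + m1 * y + m2 * z) + d" for x y z
    unfolding Q_def mult.assoc[of c0] mult.assoc[of c1] mult.assoc[of c2] p0 p1 p2
    unfolding lin m minus A_def B_def C_def m0_def m1_def m2_def by (simp add: algebra_simps)
  \<comment> \<open>Over the first four points everything except \<open>C\<close> occurs an even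
    number of times.\<close>
  have "C * (1 + a) + 2 * (A * (2 * a + 1) + B * (a\<^sup>2 + a + 2) + C * (a + 1)\<^sup>2
        + m0 * (1 + a) + m1 + m2 * (1 + a) + 2 * d)
      = Q 1 0 a + Q 1 1 a + Q a 0 1 + Q a 1 1"
    unfolding Q by (simp add: algebra_simps power2_eq_square)
  then have "C * (1 + a) = 0"
    by (simp add: two zero)
  moreover have nz: "1 + a \<noteq> 0"
  proof
    assume "1 + a = 0"
    then have "a = - 1"
      by (rule add_eq_0_iff[THEN iffD1])
    then show False
      using a(2) unfolding minus by contradiction
  qed
  ultimately have C: "C = 0"
    using mult_eq_0_iff by blast
  have "(1 + a) * (B * (1 + a) + m0 + m2) + 2 * (a * A - a * B + d) = Q 1 0 a + Q a 0 1"
    unfolding Q C by (simp add: algebra_simps power2_eq_square)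
  then have 1: "B * (1 + a) + m0 + m2 = 0"
    using nz by (simp add: two zero)
  \<comment> \<open>The last pair gives a second equation for \<open>B\<close> and
    \<open>m0 + m2\<close>; its difference from the first is \<open>B * a * (1 + a)\<close>.\<close>
  have "(1 + a)\<^sup>2 * (B * (1 + a)\<^sup>2 + m0 + m2)
      + 2 * (2 * a\<^sup>2 * A - B * (a + 3 * a\<^sup>2 + a ^ 3) - a * (m0 + m2) + a * m1 + d)
      = Q 1 a (a\<^sup>2) + Q (a\<^sup>2) a 1"
    unfolding Q C by (simp add: algebra_simps power2_eq_square power3_eq_cube)
  then have "B * (1 + a)\<^sup>2 + m0 + m2 = 0"
    using nz by (simp add: two zero)
  with 1 have "B * a * (1 + a) = 0"
    by algebra
  then have B: "B = 0"
    using a nz by simp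
  with 1 have "m0 = - m2"
    by (simp add: eq_neg_iff_add_eq_0)
  then have m02: "m0 = m2"
    unfolding minus .
  have "A + m1 + 2 * (A * a + m0 + a * m2 + d) = Q 1 0 a + Q 1 1 a"
    unfolding Q B C by (simp add: algebra_simps)
  then have m1: "m1 = A"
    using minus(1)[of A] by (simp add: two zero add_eq_0_iff)
  have "m2 * a * (1 + a) + 2 * (A * a + m2 + d + a\<^sup>2 * A) = Q 1 0 a + Q 1 a (a\<^sup>2)"
    unfolding Q B C m1 m02 by (simp add: algebra_simps power2_eq_square)
  then have m2: "m2 = 0"
    using a nz by (simp add: two zero)
  then have "a * A + d = Q 1 0 a"
    unfolding Q B C m1 m02 by simp
  then have "d = - (a * A)"
    by (simp add: zero eq_neg_iff_add_eq_0 add.commute)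
  then have "d = a * A"
    unfolding minus .
  then have "Q x y z = A * (x * z + y\<^sup>2 + y + a)" for x y z
    unfolding Q B C m1 m02 m2 by algebra
  moreover have "A = 0" if "c0 = 0 \<and> c1 = 0 \<and> c2 = 0"
    using that by (simp add: A_def)
  moreover have "c0 = 0 \<and> c1 = 0 \<and> c2 = 0 \<and> l0 = 0 \<and> l1 = 0 \<and> l2 = 0" if "A = 0"
  proof -
    have "c0 * o0\<^sup>2 + c1 * o1\<^sup>2 + c2 * o2\<^sup>2 = A - C" "l0 * o0\<^sup>2 + l1 * o1\<^sup>2 + l2 * o2\<^sup>2 = m0 - m2"
      unfolding A_def C_def m0_def m2_def by algebra+
    then show ?thesis
      using vandermonde3_eq_0[of c0 c1 c2 o0 o1 o2] vandermonde3_eq_0[of l0 l1 l2 o0 o1 o2]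
        dist B C m02 m2 m1 that unfolding B_def C_def m1_def m2_def by auto
  qed
  ultimately show ?thesis
    by blast
qed

text \<open>The parameters 0, 1 and - 1 separate the coefficients of the quadratic in
  \<open>s\<close>. The direction then satisfies \<open>u * w = v^2\<close>, and eliminating
  \<open>z\<close> and \<open>w\<close> turns \<open>u^2 * a\<close> into a square; for
  \<open>u = 0\<close> one finds \<open>a = y^2\<close>.\<close>

lemma line_in_quadric_odd:
  fixes a :: "'a::field"
  assumes zero: "\<And>s. (x + s * u) * (z + s * w) - (y + s * v)\<^sup>2 + a = 0"
    and two: "(2 :: 'a) \<noteq> 0" and nz: "u \<noteq> 0 \<or> v \<noteq> 0 \<or> w \<noteq> 0"
  shows "\<exists>b. a = b\<^sup>2"
proof -
  have q: "x * z - y\<^sup>2 + a = 0"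
    using zero[of 0] by simp
  have "(x + u) * (z + w) - (y + v)\<^sup>2 + a = 0" "(x - u) * (z - w) - (y - v)\<^sup>2 + a = 0"
    using zero[of 1] zero[of "- 1"] by simp_all
  then have "2 * (u * w - v\<^sup>2) = 0" "2 * (x * w + z * u - 2 * y * v) = 0"
    using q by algebra+
  then have q2: "u * w = v\<^sup>2" "x * w + z * u = 2 * y * v"
    using two unfolding mult_eq_0_iff by auto
  show ?thesis
  proof (cases "u = 0")
    case True
    then have "w \<noteq> 0" "x = 0"
      using q2 nz by auto
    then show ?thesis
      using q by auto
  next
    case False
    have "u\<^sup>2 * a = (u * y - x * v)\<^sup>2"
      using q q2 by algebra
    then have "a = ((u * y - x * v) / u)\<^sup>2"
      using False by (simp add: power_divide field_simps)
    then show ?thesis ..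
  qed
qed

lemma line_in_quadric_even:
  fixes a :: "'a::field"
  assumes zero: "\<And>s. (x + s * u) * (z + s * w) + (y + s * v)\<^sup>2 + (y + s * v) + a = 0"
    and two: "(2 :: 'a) = 0" and a: "a \<noteq> 0" "a \<noteq> 1" and nz: "u \<noteq> 0 \<or> v \<noteq> 0 \<or> w \<noteq> 0"
  shows "\<exists>b. a = b\<^sup>2 + b"
proof -
  \<comment> \<open>In characteristic two - 1 is no new parameter value; \<open>a\<close>, being
    neither 0 nor 1, serves as the third one.\<close>
  have "a * (a - 1) * (u * w + v\<^sup>2) = 0" and q: "x * z + y\<^sup>2 + y + a = 0"
    using zero[of 0] zero[of 1] zero[of a] by algebra+
  then have q2: "u * w + v\<^sup>2 = 0"
    using a by auto
  have "x * w + z * u + v + 2 * (y * v) = 0"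
    using zero[of 1] q q2 by algebra
  then have q1: "x * w + z * u + v = 0"
    by (simp add: two)
  show ?thesis
  proof (cases "u = 0")
    case True
    then have "w \<noteq> 0" "x = 0"
      using q1 q2 nz by auto
    then have "a = - (y\<^sup>2 + y)"
      using q by algebra
    then have "a = y\<^sup>2 + y"
      unfolding char_two_minus[OF two] .
    then show ?thesis ..
  next
    case False
    have "u\<^sup>2 * a + 2 * (u\<^sup>2 * y\<^sup>2 + x\<^sup>2 * v\<^sup>2 + u\<^sup>2 * y + u * y * x * v)
        = (u * y + x * v)\<^sup>2 + u * (u * y + x * v)"
      using q q1 q2 by algebra
    then have "u\<^sup>2 * a = (u * y + x * v)\<^sup>2 + u * (u * y + x * v)"
      by (simp add: two)
    moreover define m where "m = (u * y + x * v) / u"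
    then have "u * y + x * v = u * m"
      using False by simp
    ultimately have "u\<^sup>2 * a = u\<^sup>2 * (m\<^sup>2 + m)"
      by algebra
    then have "a = m\<^sup>2 + m"
      using False by simp
    then show ?thesis ..
  qed
qed

section \<open>Coordinates of \<Pi> as elements of the cubic field\<close>

context cubic_extension
begin

text \<open>At \<open>(1, s, s^2)\<close> the value is
  \<open>(s - frob \<theta>) * (s - frob (frob \<theta>))\<close>: this is one side of the triangle
  of conjugate points, and its conjugates are the other two sides.\<close>

definition affine_param :: "'k \<Rightarrow> 'f \<Rightarrow> 'f \<Rightarrow> 'f \<Rightarrow> 'k" where
  "affine_param \<theta> x y z =
     e z - (frob \<theta> + frob (frob \<theta>)) * e y + frob \<theta> * frob (frob \<theta>) * e x"

lemma frob_affine_param: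
  "frob (affine_param \<theta> x y z) =
     e z - (\<theta> + frob (frob \<theta>)) * e y + \<theta> * frob (frob \<theta>) * e x"
  "frob (frob (affine_param \<theta> x y z)) = e z - (\<theta> + frob \<theta>) * e y + \<theta> * frob \<theta> * e x"
  by (simp_all add: affine_param_def frob_add frob_diff frob_mult algebra_simps)

lemma frob_neq:
  assumes "frob \<theta> \<noteq> \<theta>"
  shows "\<theta> \<noteq> frob \<theta>" "\<theta> \<noteq> frob (frob \<theta>)" "frob \<theta> \<noteq> frob (frob \<theta>)"
  using assms by (metis frob_frob_frob)+

lemma affine_param_linear:
  "affine_param \<theta> (x + s * u) (y + s * v) (z + s * w)
     = affine_param \<theta> x y z + e s * affine_param \<theta> u v w"
  by (simp add: affine_param_def e_add e_mult algebra_simps)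

lemma affine_param_minus:
  "affine_param \<theta> (- x) (- y) (- z) = - affine_param \<theta> x y z"
  by (simp add: affine_param_def e_minus algebra_simps)

lemma affine_param_eq_0:
  assumes "frob \<theta> \<noteq> \<theta>" "affine_param \<theta> x y z = 0"
  shows "x = 0 \<and> y = 0 \<and> z = 0"
proof -
  note ne = frob_neq[OF assms(1)]
  have z: "affine_param \<theta> x y z = 0" "frob (affine_param \<theta> x y z) = 0"
      "frob (frob (affine_param \<theta> x y z)) = 0"
    using assms(2) by auto
  note z' = z[unfolded frob_affine_param(2), unfolded frob_affine_param(1), unfolded affine_param_def]
  have "(\<theta> - frob \<theta>) * (e y - frob (frob \<theta>) * e x) = 0"
    using z'(1,2) by algebra
  moreover have "(\<theta> - frob (frob \<theta>)) * (e y - frob \<theta> * e x) = 0"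
    using z'(1,3) by algebra
  ultimately have y: "e y = frob (frob \<theta>) * e x" "e y = frob \<theta> * e x"
    using ne by auto
  then have x: "x = 0"
    using ne by auto
  then have "y = 0"
    using y by auto
  with x show ?thesis
    using assms(2) by (simp add: affine_param_def)
qed

lemma affine_param_eq_iff:
  assumes "frob \<theta> \<noteq> \<theta>"
  shows "affine_param \<theta> x y z = affine_param \<theta> u v w \<longleftrightarrow> x = u \<and> y = v \<and> z = w"
proof
  assume "affine_param \<theta> x y z = affine_param \<theta> u v w"
  then have "affine_param \<theta> (x - u) (y - v) (z - w) = 0"
    using affine_param_linear[of \<theta> x "- 1" u y v z w] by (simp add: e_minus)
  from affine_param_eq_0[OF assms this] show "x = u \<and> y = v \<and> z = w"
    by simp
qed simp

lemma affine_param_surj: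
  assumes "frob \<theta> \<noteq> \<theta>"
  obtains x y z where "t = affine_param \<theta> x y z"
proof -
  let ?h = "\<lambda>(x, y, z). affine_param \<theta> x y z"
  have "inj ?h"
    by (auto simp: inj_def affine_param_eq_iff[OF assms])
  then have "card (range ?h) = CARD('f \<times> 'f \<times> 'f)"
    by (rule card_image)
  also have "\<dots> = CARD('k)"
    by (simp add: card_extension power3_eq_cube)
  finally have "range ?h = UNIV"
    by (intro card_subset_eq) auto
  then have "t \<in> range ?h"
    by simp
  then show ?thesis
    using that by auto
qed

text \<open>Points with last coordinate - 1 have the negated parameter. A non-square
  \<open>a\<close> differs from 1, so both exceptional values in the elimination are
  avoided.\<close>

lemma only_lineless_quadrics_odd:
  assumes \<theta>: "frob \<theta> \<noteq> \<theta>" "\<theta> ^ 3 + e c = 0"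
    and two: "(2 :: 'f) \<noteq> 0" and a: "\<nexists>b. a = b\<^sup>2" "a \<noteq> 1 / 2"
  shows "only_lineless_quadrics
    {affine_param \<theta> 1 0 (- a), - affine_param \<theta> 1 0 (- a),
     affine_param \<theta> 1 1 (1 - a), affine_param \<theta> 1 (- 1) (1 - a),
     - affine_param \<theta> 1 1 (1 - a), - affine_param \<theta> 1 (- 1) (1 - a)}"
  unfolding only_lineless_quadrics_def
proof (intro allI impI)
  fix c0 c1 c2 l0 l1 l2 d
  let ?S = "affine_param \<theta>"
  assume van: "\<forall>t\<in>{?S 1 0 (- a), - ?S 1 0 (- a), ?S 1 1 (1 - a), ?S 1 (- 1) (1 - a),
     - ?S 1 1 (1 - a), - ?S 1 (- 1) (1 - a)}. quad c0 c1 c2 l0 l1 l2 d t = 0"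
  define Q where "Q = (\<lambda>r x y z.
      c0 * (z - (\<theta> + frob (frob \<theta>)) * y + \<theta> * frob (frob \<theta>) * x) * (z - (\<theta> + frob \<theta>) * y + \<theta> * frob \<theta> * x)
      + c1 * (z - (frob \<theta> + frob (frob \<theta>)) * y + frob \<theta> * frob (frob \<theta>) * x) * (z - (\<theta> + frob \<theta>) * y + \<theta> * frob \<theta> * x)
      + c2 * (z - (frob \<theta> + frob (frob \<theta>)) * y + frob \<theta> * frob (frob \<theta>) * x)
           * (z - (\<theta> + frob (frob \<theta>)) * y + \<theta> * frob (frob \<theta>) * x)
      + r * (l0 * (z - (frob \<theta> + frob (frob \<theta>)) * y + frob \<theta> * frob (frob \<theta>) * x)
             + l1 * (z - (\<theta> + frob (frob \<theta>)) * y + \<theta> * frob (frob \<theta>) * x)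
             + l2 * (z - (\<theta> + frob \<theta>) * y + \<theta> * frob \<theta> * x)) + d)"
  have Q1: "quad c0 c1 c2 l0 l1 l2 d (?S x y z) = Q 1 (e x) (e y) (e z)" for x y z
    unfolding quad_def frob_affine_param(2) unfolding frob_affine_param(1) Q_def by (simp add: affine_param_def)
  have Qm1: "quad c0 c1 c2 l0 l1 l2 d (- ?S x y z) = Q (- 1) (e x) (e y) (e z)" for x y z
    unfolding quad_def frob_minus frob_affine_param(2) unfolding frob_affine_param(1) Q_def
    by (simp add: affine_param_def algebra_simps)
  have "frob (\<theta> ^ 3 + e c) = 0"
    unfolding \<theta>(2) by simp
  then have root1: "frob \<theta> ^ 3 + e c = 0"
    by (simp add: frob_add frob_power)
  then have "frob (frob \<theta> ^ 3 + e c) = 0"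
    by simp
  then have "frob (frob \<theta>) ^ 3 + e c = 0"
    by (simp add: frob_add frob_power)
  note roots = root1 this
  have two': "(2 :: 'k) \<noteq> 0"
    using two e_eq_0_iff[of 2] by simp
  have a1: "e a \<noteq> 1"
    using a(1) e_eq_iff[of a 1] by (metis e_1 one_power2)
  have a2: "2 * e a \<noteq> 1"
  proof
    assume "2 * e a = 1"
    then have "e (2 * a) = e 1"
      by (simp add: e_mult)
    then show False
      using a(2) two by (simp only: e_eq_iff) (simp add: field_simps)
  qed
  have *: "l0 = 0 \<and> l1 = 0 \<and> l2 = 0 \<and> (\<exists>A. (A = 0 \<longrightarrow> c0 = 0 \<and> c1 = 0 \<and> c2 = 0) \<and>
       (\<forall>x y z. Q 1 x y z = A * (x * z - y\<^sup>2 + e a)))"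
    by (rule quadric_pencil_odd[OF \<theta>(2) roots frob_neq[OF \<theta>(1)] two' a1 a2])
      (use van in \<open>simp_all add: Q1 Qm1 e_minus e_diff Q_def[THEN fun_cong, THEN fun_cong, THEN fun_cong, THEN fun_cong]\<close>)
  then obtain A where A: "A = 0 \<Longrightarrow> c0 = 0 \<and> c1 = 0 \<and> c2 = 0"
    "\<And>x y z. Q 1 x y z = A * (x * z - y\<^sup>2 + e a)"
    by blast
  show "if c0 = 0 \<and> c1 = 0 \<and> c2 = 0 then l0 = 0 \<and> l1 = 0 \<and> l2 = 0
      else \<forall>t v. v \<noteq> 0 \<longrightarrow> (\<exists>s. quad c0 c1 c2 l0 l1 l2 d (t + e s * v) \<noteq> 0)"
  proof (cases "c0 = 0 \<and> c1 = 0 \<and> c2 = 0")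
    case False
    have "\<exists>s. quad c0 c1 c2 l0 l1 l2 d (t + e s * v) \<noteq> 0" if "v \<noteq> 0" for t v
    proof (rule ccontr)
      assume neg: "\<not> ?thesis"
      obtain x y z where t: "t = ?S x y z"
        by (rule affine_param_surj[OF \<theta>(1)])
      obtain u1 u2 u3 where v: "v = ?S u1 u2 u3"
        by (rule affine_param_surj[OF \<theta>(1)])
      \<comment> \<open>With \<open>A\<close> nonzero and \<open>e\<close> injective the equation
        descends to \<open>'f\<close>, the field in which \<open>a\<close> is a non-square.\<close>
      have "(x + s * u1) * (z + s * u3) - (y + s * u2)\<^sup>2 + a = 0" for s
      proof -
        have "quad c0 c1 c2 l0 l1 l2 d (t + e s * v) = 0"
          using neg by blast
        then have "A * e ((x + s * u1) * (z + s * u3) - (y + s * u2)\<^sup>2 + a) = 0"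
          unfolding t v affine_param_linear[symmetric] Q1 A(2)
          by (simp add: e_add e_mult e_diff e_power)
        then show ?thesis
          using A(1) False by auto
      qed
      moreover have "u1 \<noteq> 0 \<or> u2 \<noteq> 0 \<or> u3 \<noteq> 0"
        using \<open>v \<noteq> 0\<close> unfolding v by (auto simp: affine_param_def)
      ultimately show False
        using line_in_quadric_odd[OF _ two] a(1) by blast
    qed
    then show ?thesis
      using False by auto
  qed (use * in auto)
qed

lemma only_lineless_quadrics_even:
  assumes \<theta>: "frob \<theta> \<noteq> \<theta>" "\<theta> ^ 3 + \<theta> + 1 = 0"
    and two: "(2 :: 'f) = 0" and a: "\<nexists>b. a = b\<^sup>2 + b" "a \<noteq> 1"
  shows "only_lineless_quadrics
    {affine_param \<theta> 1 0 a, affine_param \<theta> 1 1 a, affine_param \<theta> a 0 1, affine_param \<theta> a 1 1,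
     affine_param \<theta> 1 a (a\<^sup>2), affine_param \<theta> (a\<^sup>2) a 1}"
  unfolding only_lineless_quadrics_def
proof (intro allI impI)
  fix c0 c1 c2 l0 l1 l2 d
  let ?S = "affine_param \<theta>"
  assume van: "\<forall>t\<in>{?S 1 0 a, ?S 1 1 a, ?S a 0 1, ?S a 1 1, ?S 1 a (a\<^sup>2), ?S (a\<^sup>2) a 1}.
     quad c0 c1 c2 l0 l1 l2 d t = 0"
  define Q where "Q = (\<lambda>x y z.
      c0 * (z - (\<theta> + frob (frob \<theta>)) * y + \<theta> * frob (frob \<theta>) * x) * (z - (\<theta> + frob \<theta>) * y + \<theta> * frob \<theta> * x)
      + c1 * (z - (frob \<theta> + frob (frob \<theta>)) * y + frob \<theta> * frob (frob \<theta>) * x) * (z - (\<theta> + frob \<theta>) * y + \<theta> * frob \<theta> * x)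
      + c2 * (z - (frob \<theta> + frob (frob \<theta>)) * y + frob \<theta> * frob (frob \<theta>) * x)
           * (z - (\<theta> + frob (frob \<theta>)) * y + \<theta> * frob (frob \<theta>) * x)
      + (l0 * (z - (frob \<theta> + frob (frob \<theta>)) * y + frob \<theta> * frob (frob \<theta>) * x)
             + l1 * (z - (\<theta> + frob (frob \<theta>)) * y + \<theta> * frob (frob \<theta>) * x)
             + l2 * (z - (\<theta> + frob \<theta>) * y + \<theta> * frob \<theta> * x)) + d)"
  have Q1: "quad c0 c1 c2 l0 l1 l2 d (?S x y z) = Q (e x) (e y) (e z)" for x y z
    unfolding quad_def frob_affine_param(2) unfolding frob_affine_param(1) Q_def by (simp add: affine_param_def)
  have "frob (\<theta> ^ 3 + \<theta> + 1) = 0"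
    unfolding \<theta>(2) by simp
  then have root1: "frob \<theta> ^ 3 + frob \<theta> + 1 = 0"
    by (simp add: frob_add frob_power)
  then have "frob (frob \<theta> ^ 3 + frob \<theta> + 1) = 0"
    by simp
  then have "frob (frob \<theta>) ^ 3 + frob (frob \<theta>) + 1 = 0"
    by (simp add: frob_add frob_power)
  note roots = root1 this
  have two': "(2 :: 'k) = 0"
    using two e_numeral[of "num.Bit0 num.One"] by simp
  have "a \<noteq> 0"
    using a(1) by (metis add_0 zero_power2)
  then have a': "e a \<noteq> 0" "e a \<noteq> 1"
    using a(2) e_eq_iff[of a 1] by auto
  have "\<exists>A. (A = 0 \<longleftrightarrow> c0 = 0 \<and> c1 = 0 \<and> c2 = 0) \<and> (A = 0 \<longrightarrow> l0 = 0 \<and> l1 = 0 \<and> l2 = 0) \<and>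
       (\<forall>x y z. Q x y z = A * (x * z + y\<^sup>2 + y + e a))"
    by (rule quadric_pencil_even[OF \<theta>(2) roots frob_neq[OF \<theta>(1)] two' a'])
      (use van in \<open>simp_all add: Q1 e_power Q_def[THEN fun_cong, THEN fun_cong, THEN fun_cong]\<close>)
  then obtain A where A: "A = 0 \<longleftrightarrow> c0 = 0 \<and> c1 = 0 \<and> c2 = 0" "A = 0 \<longrightarrow> l0 = 0 \<and> l1 = 0 \<and> l2 = 0"
    "\<And>x y z. Q x y z = A * (x * z + y\<^sup>2 + y + e a)"
    by blast
  show "if c0 = 0 \<and> c1 = 0 \<and> c2 = 0 then l0 = 0 \<and> l1 = 0 \<and> l2 = 0
      else \<forall>t v. v \<noteq> 0 \<longrightarrow> (\<exists>s. quad c0 c1 c2 l0 l1 l2 d (t + e s * v) \<noteq> 0)"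
  proof (cases "A = 0")
    case False
    have line: "\<exists>s. quad c0 c1 c2 l0 l1 l2 d (t + e s * v) \<noteq> 0" if "v \<noteq> 0" for t v
    proof (rule ccontr)
      assume neg: "\<not> ?thesis"
      obtain x y z where t: "t = ?S x y z"
        by (rule affine_param_surj[OF \<theta>(1)])
      obtain u1 u2 u3 where v: "v = ?S u1 u2 u3"
        by (rule affine_param_surj[OF \<theta>(1)])
      have "(x + s * u1) * (z + s * u3) + (y + s * u2)\<^sup>2 + (y + s * u2) + a = 0" for s
      proof -
        have "quad c0 c1 c2 l0 l1 l2 d (t + e s * v) = 0"
          using neg by blast
        then have "A * e ((x + s * u1) * (z + s * u3) + (y + s * u2)\<^sup>2 + (y + s * u2) + a) = 0"
          unfolding t v affine_param_linear[symmetric] Q1 A(3)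
          by (simp add: e_add e_mult e_power)
        then show ?thesis
          using False by auto
      qed
      moreover have "u1 \<noteq> 0 \<or> u2 \<noteq> 0 \<or> u3 \<noteq> 0"
        using \<open>v \<noteq> 0\<close> unfolding v by (auto simp: affine_param_def)
      ultimately show False
        using line_in_quadric_even[OF _ two \<open>a \<noteq> 0\<close> a(2)] a(1) by blast
    qed
    show ?thesis
      using A(1) line \<open>A \<noteq> 0\<close> by auto
  qed (use A in auto)
qed

end

section \<open>Linear sets of rank 3 and higgledy-piggledy planes\<close>

lemma card_span_independent:
  fixes A :: "('a::{field,finite}^'n) set"
  assumes "vec.independent A"
  shows "card (vec.span A) = CARD('a) ^ card A"
proof -
  have "finite A" by simp
  then show ?thesis
    using assms
  proof (induction A rule: finite_induct)
    case empty
    then show ?case by simp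
  next
    case (insert b A)
    then have A: "vec.independent A" and b: "b \<notin> vec.span A"
      by (auto simp: vec.independent_insert)
    let ?f = "\<lambda>(c, x). c *s b + x"
    have "inj_on ?f (UNIV \<times> vec.span A)"
    proof (rule inj_onI, clarify)
      fix c x d y
      assume x: "x \<in> vec.span A" and y: "y \<in> vec.span A" and eq: "c *s b + x = d *s b + y"
      from eq have *: "(c - d) *s b = y - x"
        by (simp add: vector_sub_rdistrib algebra_simps)
      have "c = d"
      proof (rule ccontr)
        assume "c \<noteq> d"
        then have "inverse (c - d) *s ((c - d) *s b) = b"
          by (simp only: vector_smult_assoc) simp
        then have "b = inverse (c - d) *s (y - x)"
          by (simp only: *)
        then have "b \<in> vec.span A"
          using x y by (simp add: vec.span_scale vec.span_diff)
        with b show False ..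
      qed
      with eq show "c = d \<and> x = y"
        by simp
    qed
    moreover have "?f ` (UNIV \<times> vec.span A) = vec.span (insert b A)"
    proof (intro equalityI subsetI)
      fix x assume "x \<in> ?f ` (UNIV \<times> vec.span A)"
      then obtain c y where "x = c *s b + y" "y \<in> vec.span A"
        by auto
      then have "x - c *s b \<in> vec.span A"
        by simp
      then show "x \<in> vec.span (insert b A)"
        unfolding vec.span_insert by blast
    next
      fix x assume "x \<in> vec.span (insert b A)"
      then obtain c where "x - c *s b \<in> vec.span A"
        unfolding vec.span_insert by blast
      moreover have "x = ?f (c, x - c *s b)"
        by simp
      ultimately show "x \<in> ?f ` (UNIV \<times> vec.span A)"
        by blast
    qed
    ultimately have "card (vec.span (insert b A)) = CARD('a) * card (vec.span A)"
      by (metis card_image card_cartesian_product)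
    then show ?case
      using insert A by simp
  qed
qed

lemma card_subspace:
  fixes U :: "('a::{field,finite}^'n) set"
  assumes "vec.subspace U"
  shows "card U = CARD('a) ^ vec.dim U"
proof -
  obtain A where A: "A \<subseteq> U" "vec.independent A" "U \<subseteq> vec.span A" "card A = vec.dim U"
    using vec.basis_exists by blast
  then have "vec.span A = U"
    using assms by (simp add: vec.span_minimal subset_antisym)
  then show ?thesis
    using card_span_independent[OF A(2)] A(4) by simp
qed

lemma subspaces_meet:
  fixes U V W :: "('a::field^'n) set"
  assumes "vec.subspace U" "vec.subspace V" "vec.subspace W" "U \<subseteq> W" "V \<subseteq> W"
    and "vec.dim W < vec.dim U + vec.dim V"
  obtains x where "x \<noteq> 0" "x \<in> U" "x \<in> V"
proof -
  have "vec.dim {x + y |x y. x \<in> U \<and> y \<in> V} \<le> vec.dim W"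
    using assms by (intro vec.dim_subset) (auto intro: vec.subspace_add)
  then have "vec.dim (U \<inter> V) \<noteq> 0"
    using vec.dim_sums_Int[OF assms(1,2)] assms(6) by linarith
  then have "\<not> U \<inter> V \<subseteq> {0}"
    by simp
  then show ?thesis
    using that by blast
qed

lemma mem_span_three:
  "x \<in> vec.span {u, v, w} \<longleftrightarrow> (\<exists>a b c. x = a *s u + b *s v + c *s (w :: 'a::field^'n))"
  by (auto simp: vec.span_insert vec.span_singleton algebra_simps diff_eq_eq)

lemma mem_span_two:
  "x \<in> vec.span {u, v} \<longleftrightarrow> (\<exists>a b. x = a *s u + b *s (v :: 'a::field^'n))"
  by (auto simp: vec.span_insert vec.span_singleton algebra_simps diff_eq_eq)

text \<open>If \<open>u\<close> and \<open>v\<close> already span \<open>V\<close>, some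
  \<open>w\<close> outside is added, so that later computations always have three independent
  generators.\<close>

lemma subspace_within_three_span:
  fixes V W :: "('a::field^'n) set"
  assumes "vec.subspace V" "V \<subseteq> W" "vec.dim V \<le> 3" "3 \<le> vec.dim W"
    and uv: "u \<in> V" "v \<in> V" "u \<notin> vec.span {v}" "v \<noteq> 0"
  obtains w where "w \<in> W" "w \<notin> vec.span {u, v}" "V \<subseteq> vec.span {u, v, w}"
proof -
  have ind: "vec.independent {u, v}" and ne: "u \<noteq> v"
    using uv(3,4) by (auto simp: vec.independent_insert vec.span_base)
  then obtain A where A: "{u, v} \<subseteq> A" "A \<subseteq> V" "vec.independent A" "V \<subseteq> vec.span A"
    using vec.maximal_independent_subset_extend[of "{u, v}" V] uv by auto
  have fin: "finite A"
    using A(3) by (rule vec.finiteI_independent)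
  have card: "card A \<le> 3"
    using vec.independent_card_le_dim[OF A(2,3)] assms(3) by simp
  show thesis
  proof (cases "A = {u, v}")
    case True
    have "\<not> W \<subseteq> vec.span {u, v}"
    proof
      assume "W \<subseteq> vec.span {u, v}"
      then have "vec.dim W \<le> card {u, v}"
        by (rule vec.dim_le_card) simp
      then show False
        using assms(4) ne by simp
    qed
    then obtain w where w: "w \<in> W" "w \<notin> vec.span {u, v}"
      by blast
    have "vec.span {u, v} \<subseteq> vec.span {u, v, w}"
      by (rule vec.span_mono) auto
    then show thesis
      using that[OF w] A(4) True by auto
  next
    case False
    then obtain w where w: "w \<in> A" "w \<notin> {u, v}"
      using A(1) by blast
    have "card {u, v, w} = 3"
      using ne w by auto
    moreover have "{u, v, w} \<subseteq> A"
      using A(1) w by auto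
    ultimately have eq: "{u, v, w} = A"
      using card fin by (metis card_seteq)
    have "A = insert w {u, v}"
      using eq by auto
    then have "w \<notin> vec.span {u, v}"
      using A(3) w(2) vec.independent_insert[of w "{u, v}"] by simp
    moreover have "w \<in> W"
      using w(1) A(2) assms(2) by blast
    ultimately show thesis
      using that A(4) eq by blast
  qed
qed

section \<open>Field reduction of subspaces\<close>

locale cubic_field_reduction = cubic_extension e
  for e :: "'f::{field,finite} \<Rightarrow> 'k::{field,finite}" +
  fixes \<beta> :: "'k^'r \<Rightarrow> 'f^'m"
  assumes reduction: "field_reduction e \<beta>"
begin

lemma bij_beta: "bij \<beta>" and beta_add: "\<beta> (x + y) = \<beta> x + \<beta> y"
  and beta_scale: "\<beta> (e c *s x) = c *s \<beta> x"
  using reduction by (auto simp: field_reduction_def)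

lemma beta_eq_iff [simp]: "\<beta> x = \<beta> y \<longleftrightarrow> x = y"
  using bij_beta by (metis bij_is_inj injD)

lemma beta_0 [simp]: "\<beta> 0 = 0"
  using beta_scale[of 0 0] by simp

lemma beta_eq_0_iff [simp]: "\<beta> x = 0 \<longleftrightarrow> x = 0"
  using beta_eq_iff[of x 0] by simp

lemma beta_mem_image_iff [simp]: "\<beta> x \<in> \<beta> ` U \<longleftrightarrow> x \<in> U"
  by auto

lemma subspace_beta:
  assumes "vec.subspace U"
  shows "vec.subspace (\<beta> ` U)"
proof (rule vec.subspaceI)
  show "0 \<in> \<beta> ` U"
    using vec.subspace_0[OF assms] by (metis beta_0 imageI)
  show "x + y \<in> \<beta> ` U" if "x \<in> \<beta> ` U" "y \<in> \<beta> ` U" for x y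
    using that vec.subspace_add[OF assms] by (auto simp flip: beta_add)
  show "c *s x \<in> \<beta> ` U" if "x \<in> \<beta> ` U" for c x
    using that vec.subspace_scale[OF assms] by (auto simp flip: beta_scale)
qed

text \<open>The two sides are spaces over different fields, so dimensions are compared by counting
  elements.\<close>

lemma dim_beta:
  assumes "vec.subspace U"
  shows "vec.dim (\<beta> ` U) = 3 * vec.dim U"
proof -
  have "card (\<beta> ` U) = card U"
    by (rule card_image) (simp add: inj_on_def)
  then have "CARD('f) ^ vec.dim (\<beta> ` U) = CARD('f) ^ (3 * vec.dim U)"
    using card_subspace[OF assms] card_subspace[OF subspace_beta[OF assms]]
    by (simp add: card_extension power_mult)
  then show ?thesis
    using card_base_gt_1 by simp
qed

lemma proj_sub_beta: "proj_sub d U \<Longrightarrow> proj_sub (3 * d + 2) (\<beta> ` U)"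
  by (simp add: proj_sub_def subspace_beta dim_beta)

section \<open>The points of a line in a fixed frame\<close>

context
  fixes g p :: "'k^'r" and T :: "'k set"
  assumes indep: "\<And>x y. x *s g + y *s p = 0 \<Longrightarrow> x = 0 \<and> y = 0"
begin

lemma combination_eq_iff: "x *s g + y *s p = x' *s g + y' *s p \<longleftrightarrow> x = x' \<and> y = y'"
proof
  assume "x *s g + y *s p = x' *s g + y' *s p"
  then have "(x - x') *s g + (y - y') *s p = 0"
    by (simp add: vector_sub_rdistrib algebra_simps)
  then show "x = x' \<and> y = y'"
    using indep by fastforce
qed simp

lemma combination_distinct:
  "p \<noteq> 0" "g + t *s p \<noteq> 0" "p \<notin> vec.span {g + t *s p}"
  "g + s *s p \<in> vec.span {g + t *s p} \<longleftrightarrow> s = t"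
proof -
  show "p \<noteq> 0" "g + t *s p \<noteq> 0"
    using indep[of 0 1] indep[of 1 t] by auto
  have scale: "c *s (g + t *s p) = c *s g + (c * t) *s p" for c
    by (simp add: vector_add_ldistrib vector_smult_assoc)
  show "p \<notin> vec.span {g + t *s p}"
  proof
    assume "p \<in> vec.span {g + t *s p}"
    then obtain c where "p = c *s g + (c * t) *s p"
      by (auto simp: vec.span_singleton scale)
    then show False
      using combination_eq_iff[of 0 1 c "c * t"] by auto
  qed
  show "g + s *s p \<in> vec.span {g + t *s p} \<longleftrightarrow> s = t"
  proof
    assume "g + s *s p \<in> vec.span {g + t *s p}"
    then obtain c where "g + s *s p = c *s g + (c * t) *s p"
      by (auto simp: vec.span_singleton scale)
    then show "s = t"
      using combination_eq_iff[of 1 s c "c * t"] by simp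
  qed (simp add: vec.span_base)
qed

text \<open>Nonzero vectors of \<open>V\<close> over \<open>p\<close> and over the point with
  parameter \<open>r\<close> serve as two of three generators. A vector over the point with
  parameter \<open>t\<close> has coefficients \<open>z\<close> and \<open>z * t\<close>; comparing
  both with the generators and eliminating \<open>z\<close> gives the relation that the Moore
  determinant detects.\<close>

lemma no_plane_meets_all:
  assumes T: "only_lineless_quadrics T" and r: "r \<in> T"
    and V: "vec.subspace V" "V \<subseteq> \<beta> ` vec.span {g, p}" "vec.dim V \<le> 3"
    and meet_p: "\<exists>x. x \<noteq> 0 \<and> x \<in> V \<and> x \<in> \<beta> ` vec.span {p}"
    and meet: "\<And>t. t \<in> T \<Longrightarrow> \<exists>x. x \<noteq> 0 \<and> x \<in> V \<and> x \<in> \<beta> ` vec.span {g + t *s p}"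
  shows False
proof -
  have *: "\<exists>y. y \<noteq> 0 \<and> \<beta> (y *s g + (y * t) *s p) \<in> V" if "t \<in> T" for t
  proof -
    obtain y where "\<beta> (y *s (g + t *s p)) \<noteq> 0" "\<beta> (y *s (g + t *s p)) \<in> V"
      using meet[OF \<open>t \<in> T\<close>] by (auto simp: vec.span_singleton)
    then show ?thesis
      by (auto simp: vector_add_ldistrib vector_smult_assoc intro!: exI[of _ y])
  qed
  obtain y where y: "y \<noteq> 0" "\<beta> (y *s g + (y * r) *s p) \<in> V"
    using *[OF r] by blast
  obtain u where u: "u \<noteq> 0" "\<beta> (u *s p) \<in> V"
    using meet_p by (auto simp: vec.span_singleton)
  let ?v1 = "\<beta> (y *s g + (y * r) *s p)" and ?v2 = "\<beta> (u *s p)"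
  have "?v1 \<notin> vec.span {?v2}"
  proof
    assume "?v1 \<in> vec.span {?v2}"
    then obtain c where "?v1 = c *s ?v2"
      by (auto simp: vec.span_singleton)
    then have "?v1 = \<beta> (e c *s (u *s p))"
      by (simp only: beta_scale)
    then show False
      using combination_eq_iff[of y "y * r" 0 "e c * u"] y(1) by (simp add: vector_smult_assoc)
  qed
  moreover have "?v2 \<noteq> 0"
    using u(1) combination_distinct(1) by simp
  moreover have "3 \<le> vec.dim (\<beta> ` vec.span {g, p})"
  proof -
    have "vec.dim (\<beta> ` vec.span {p}) = 3"
      using combination_distinct(1) by (simp add: dim_beta)
    moreover have "\<beta> ` vec.span {p} \<subseteq> \<beta> ` vec.span {g, p}"
      by (intro image_mono vec.span_mono) auto
    ultimately show ?thesis
      by (metis vec.dim_subset)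
  qed
  ultimately obtain v3 where v3: "v3 \<in> \<beta> ` vec.span {g, p}" "v3 \<notin> vec.span {?v1, ?v2}"
      "V \<subseteq> vec.span {?v1, ?v2, v3}"
    using subspace_within_three_span[OF V _ y(2) u(2)] by metis
  then obtain w h where v3_eq: "v3 = \<beta> (w *s g + h *s p)"
    by (auto simp: mem_span_two)
  show False
  proof (rule only_lineless_quadrics_imp_not_linear_set[OF T u(1) y(1)])
    fix b c
    assume w: "w = e c * y"
    show "h - e c * y * r \<noteq> e b * u"
    proof
      assume "h - e c * y * r = e b * u"
      then have "h = e c * (y * r) + e b * u"
        by (simp add: algebra_simps)
      then have "v3 = c *s ?v1 + b *s ?v2"
        by (simp add: v3_eq w vector_add_ldistrib vector_sadd_rdistrib vector_smult_assoc mult.assoc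
            flip: beta_scale beta_add)
      then show False
        using v3(2) by (auto simp: mem_span_two)
    qed
  next
    fix t
    assume "t \<in> T"
    then obtain z where z: "z \<noteq> 0" "\<beta> (z *s g + (z * t) *s p) \<in> V"
      using * by blast
    then obtain a b c where "\<beta> (z *s g + (z * t) *s p) = a *s ?v1 + b *s ?v2 + c *s v3"
      using v3(3) mem_span_three by blast
    also have "\<dots> = \<beta> ((e a * y + e c * w) *s g + (e a * (y * r) + e b * u + e c * h) *s p)"
      by (simp add: v3_eq vector_add_ldistrib vector_sadd_rdistrib vector_smult_assoc
          flip: beta_scale beta_add)
    finally have eq: "z = e a * y + e c * w" "z * t = e a * (y * r) + e b * u + e c * h"
      unfolding beta_eq_iff combination_eq_iff by blast+
    \<comment> \<open>With \<open>a = c = 0\<close> the vector would lie over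
      \<open>p\<close>.\<close>
    from eq(1) z(1) have "a \<noteq> 0 \<or> c \<noteq> 0"
      by auto
    moreover have "e a * (y * (t - r)) + e c * (w * t - h) = e b * u"
      using eq by algebra
    ultimately show "\<exists>a b c. (a \<noteq> 0 \<or> c \<noteq> 0) \<and> e a * (y * (t - r)) + e c * (w * t - h) = e b * u"
      by blast
  qed
qed

lemma higgledy_piggledy_planes:
  assumes T: "only_lineless_quadrics T" "T \<noteq> {}"
    and K: "K = insert (\<beta> ` vec.span {p}) ((\<lambda>t. \<beta> ` vec.span {g + t *s p}) ` T)"
  shows "higgledy_piggledy 5 2 (\<beta> ` vec.span {g, p}) K" and "card K = Suc (card T)"
proof -
  let ?L = "vec.span {g, p}"
  have "g \<notin> vec.span {p}"
    using combination_eq_iff[of 1 0 0] by (auto simp: vec.span_singleton)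
  then have "vec.dim ?L = 2"
    using combination_distinct(1) by (simp add: vec.dim_insert)
  then have L: "proj_sub 5 (\<beta> ` ?L)"
    using proj_sub_beta[of 1 ?L] by (simp add: proj_sub_def)
  have plane: "proj_sub 2 (\<beta> ` vec.span {x})" if "x \<noteq> 0" for x
    using proj_sub_beta[of 0 "vec.span {x}"] that by (simp add: proj_sub_def)
  have planes: "proj_sub 2 U \<and> U \<subseteq> \<beta> ` ?L" if "U \<in> K" for U
  proof -
    have "p \<in> ?L" "g \<in> ?L"
      by (simp_all add: vec.span_base)
    then have "p \<in> ?L" "g + t *s p \<in> ?L" for t
      by (simp_all only: vec.span_add vec.span_scale)
    then have "vec.span {p} \<subseteq> ?L" "vec.span {g + t *s p} \<subseteq> ?L" for t
      by (simp_all add: vec.span_minimal)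
    then show ?thesis
      using that combination_distinct(1,2) unfolding K by (auto intro: plane)
  qed
  have "vec.span (\<kappa> \<inter> \<Union>K) = \<kappa>" if \<kappa>: "proj_sub 3 \<kappa>" "\<kappa> \<subseteq> \<beta> ` ?L" for \<kappa>
  proof (rule ccontr)
    let ?V = "vec.span (\<kappa> \<inter> \<Union>K)"
    have sub: "vec.subspace \<kappa>" "vec.dim \<kappa> = 4"
      using \<kappa>(1) by (auto simp: proj_sub_def)
    have V: "?V \<subseteq> \<kappa>"
      using sub(1) by (intro vec.span_minimal) auto
    assume "?V \<noteq> \<kappa>"
    then have "vec.dim ?V \<noteq> vec.dim \<kappa>"
      using vec.subspace_dim_equal[OF _ sub(1) V] by (metis order_refl vec.subspace_span)
    then have dim: "vec.dim ?V \<le> 3"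
      using vec.dim_subset[OF V] sub(2) by linarith
    \<comment> \<open>Vector dimensions 4 and 3 inside dimension 6 force a common nonzero
      vector.\<close>
    have meet: "\<exists>x. x \<noteq> 0 \<and> x \<in> ?V \<and> x \<in> U" if "U \<in> K" for U
    proof -
      obtain x where "x \<noteq> 0" "x \<in> \<kappa>" "x \<in> U"
        using subspaces_meet[of \<kappa> U "\<beta> ` ?L"] planes[OF \<open>U \<in> K\<close>] sub \<kappa>(2) L
        by (auto simp: proj_sub_def)
      then show ?thesis
        using that by (auto intro: vec.span_base)
    qed
    obtain r where "r \<in> T"
      using T(2) by blast
    show False
    proof (rule no_plane_meets_all[OF T(1) \<open>r \<in> T\<close> vec.subspace_span _ dim])
      show "?V \<subseteq> \<beta> ` ?L"
        using V \<kappa>(2) by (rule subset_trans)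
      show "\<exists>x. x \<noteq> 0 \<and> x \<in> ?V \<and> x \<in> \<beta> ` vec.span {p}"
        by (rule meet) (simp add: K)
      show "\<exists>x. x \<noteq> 0 \<and> x \<in> ?V \<and> x \<in> \<beta> ` vec.span {g + t *s p}" if "t \<in> T" for t
        by (rule meet) (simp add: K that)
    qed
  qed
  then show "higgledy_piggledy 5 2 (\<beta> ` ?L) K"
    using L planes by (simp add: higgledy_piggledy_def)
  have "inj_on (\<lambda>t. \<beta> ` vec.span {g + t *s p}) T"
  proof (rule inj_onI)
    fix s t
    assume "\<beta> ` vec.span {g + s *s p} = \<beta> ` vec.span {g + t *s p}"
    then have "g + s *s p \<in> vec.span {g + t *s p}"
      using vec.span_base[of "g + s *s p" "{g + s *s p}"] by (metis beta_mem_image_iff insertI1)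
    then show "s = t"
      by (simp add: combination_distinct(4))
  qed
  moreover have "\<beta> ` vec.span {p} \<notin> (\<lambda>t. \<beta> ` vec.span {g + t *s p}) ` T"
  proof
    assume "\<beta> ` vec.span {p} \<in> (\<lambda>t. \<beta> ` vec.span {g + t *s p}) ` T"
    then obtain t where "\<beta> ` vec.span {p} = \<beta> ` vec.span {g + t *s p}"
      by blast
    then have "p \<in> vec.span {g + t *s p}"
      using vec.span_base[of p "{p}"] by (metis beta_mem_image_iff insertI1)
    then show False
      by (simp add: combination_distinct(3))
  qed
  ultimately show "card K = Suc (card T)"
    by (simp add: K card_image)
qed

end

end

section \<open>Transversal lines of the extended spread\<close>

context cubic_extension
begin

lemma lift_vec_add: "lift_vec e (x + y) = lift_vec e x + lift_vec e y"
  and lift_vec_scale: "lift_vec e (c *s x) = e c *s lift_vec e x"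
  and lift_vec_0 [simp]: "lift_vec e 0 = 0"
  by (simp_all add: lift_vec_def vec_eq_iff e_add e_mult)

lemma inj_lift_vec: "inj (lift_vec e)"
  by (auto simp: inj_def lift_vec_def vec_eq_iff)

lemma lift_vec_mem_span:
  assumes "x \<in> vec.span A"
  shows "lift_vec e x \<in> vec.span (lift_vec e ` A)"
  using assms
proof (induction rule: vec.span_induct_alt)
  case base
  then show ?case
    by (simp add: vec.span_zero)
next
  case (step c x y)
  then show ?case
    by (simp add: lift_vec_add lift_vec_scale vec.span_add vec.span_scale vec.span_base)
qed

text \<open>A basis containing \<open>A\<close> lifts to a set whose span contains the unit vectors,
  since lifting fixes them; a spanning set of that size is independent.\<close>

lemma lift_vec_independent:
  fixes A :: "('f^'n) set"
  assumes "vec.independent A"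
  shows "vec.independent (lift_vec e ` A)"
proof -
  obtain A' where A': "A \<subseteq> A'" "vec.independent A'" "UNIV \<subseteq> vec.span A'"
    using vec.maximal_independent_subset_extend[OF subset_UNIV assms] by auto
  have "card A' = CARD('n)"
    using vec.dim_unique[of A' UNIV] A'(2,3) by (auto simp: vec.dim_UNIV card_cart_basis)
  have "lift_vec e (axis i 1) \<in> vec.span (lift_vec e ` A')" for i :: 'n
    using A'(3) by (intro lift_vec_mem_span) auto
  moreover have "lift_vec e (axis i 1) = axis i 1" for i :: 'n
    by (simp add: lift_vec_def vec_eq_iff axis_def)
  ultimately have "axis i 1 \<in> vec.span (lift_vec e ` A')" for i :: 'n
    by metis
  then have "vec.span (cart_basis :: ('k^'n) set) \<subseteq> vec.span (lift_vec e ` A')"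
    by (intro vec.span_minimal) (auto simp: cart_basis_def)
  then have "UNIV \<subseteq> vec.span (lift_vec e ` A')"
    by simp
  moreover have "card (lift_vec e ` A') \<le> CARD('n)"
    using card_image_le[of A' "lift_vec e"] \<open>card A' = _\<close> by simp
  ultimately have "vec.independent (lift_vec e ` A')"
    by (intro vec.card_le_dim_spanning[of _ UNIV]) (auto simp: vec.dim_UNIV card_cart_basis)
  then show ?thesis
    using A'(1) by (meson image_mono vec.independent_mono)
qed

lemma dim_ext:
  assumes "vec.subspace U"
  shows "vec.dim (ext e U) = vec.dim U"
proof -
  obtain A where A: "A \<subseteq> U" "vec.independent A" "U \<subseteq> vec.span A" "card A = vec.dim U"
    using vec.basis_exists by blast
  have "ext e U \<subseteq> vec.span (lift_vec e ` A)"
    unfolding ext_def using A(3) by (intro vec.span_minimal) (auto intro: lift_vec_mem_span)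
  moreover have "vec.span (lift_vec e ` A) \<subseteq> ext e U"
    unfolding ext_def using A(1) by (intro vec.span_mono) auto
  ultimately have "ext e U = vec.span (lift_vec e ` A)"
    by blast
  then show ?thesis
    using A(4) vec.dim_span_eq_card_independent[OF lift_vec_independent[OF A(2)]]
    by (simp add: card_image inj_on_subset[OF inj_lift_vec])
qed

text \<open>Extension preserves dimension and the extended sum lies in the sum of the extensions, so
  the dimension formula leaves no common vector. Disjoint spread elements thus stay disjoint over
  \<open>'k\<close>.\<close>

lemma ext_inter_trivial:
  assumes "vec.subspace U" "vec.subspace V" "U \<inter> V \<subseteq> {0}"
  shows "ext e U \<inter> ext e V \<subseteq> {0}"
proof -
  let ?W = "{x + y |x y. x \<in> U \<and> y \<in> V}"
  let ?E = "{x + y |x y. x \<in> ext e U \<and> y \<in> ext e V}"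
  have W: "vec.subspace ?W" and E: "vec.subspace ?E"
    using assms by (auto simp: ext_def intro: vec.subspace_sums)
  have "lift_vec e ` ?W \<subseteq> ?E"
    by (force simp: lift_vec_add ext_def intro: vec.span_base)
  then have "ext e ?W \<subseteq> ?E"
    unfolding ext_def[of e ?W] using E by (rule vec.span_minimal)
  then have "vec.dim (ext e ?W) \<le> vec.dim ?E"
    by (rule vec.dim_subset)
  then have "vec.dim ?W \<le> vec.dim ?E"
    by (simp only: dim_ext[OF W])
  moreover have "vec.dim ?W + vec.dim (U \<inter> V) = vec.dim U + vec.dim V"
    using assms by (intro vec.dim_sums_Int)
  moreover have "vec.dim ?E + vec.dim (ext e U \<inter> ext e V) = vec.dim U + vec.dim V"
    using vec.dim_sums_Int[of "ext e U" "ext e V"] dim_ext[OF assms(1)] dim_ext[OF assms(2)]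
    by (simp add: ext_def)
  moreover have "vec.dim (U \<inter> V) = 0"
    using assms(3) by simp
  ultimately have "vec.dim (ext e U \<inter> ext e V) = 0"
    by linarith
  then show ?thesis
    by simp
qed

definition galois :: "('k \<Rightarrow> 'k) set" where
  "galois = {\<lambda>x. x, frob, \<lambda>x. frob (frob x)}"

lemma galois_simps:
  assumes "F \<in> galois"
  shows "F (x + y) = F x + F y" "F (x * y) = F x * F y" "F (e c) = e c" "F x = F y \<longleftrightarrow> x = y"
    "F 0 = 0"
  using assms by (auto simp: galois_def frob_add frob_mult)

lemma galois_surj:
  assumes "F \<in> galois"
  obtains y where "x = F y"
  using assms unfolding galois_def by (metis frob_frob_frob insertE singletonD)

lemma galois_neq:
  assumes "frob c \<noteq> c" "F \<in> galois" "G \<in> galois" "F \<noteq> G"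
  shows "F c \<noteq> G c"
  using assms frob_neq[OF assms(1)] unfolding galois_def by auto

lemma lift_vec_galois:
  assumes "F \<in> galois"
  shows "lift_vec F (x + y) = lift_vec F x + lift_vec F y"
    "lift_vec F (c *s x) = F c *s lift_vec F x"
    "lift_vec F x = 0 \<longleftrightarrow> x = 0"
  using galois_simps[OF assms] by (auto simp: lift_vec_def vec_eq_iff) metis

lemma lift_vec_galois_independent:
  assumes F: "F \<in> galois"
    and indep: "\<And>x y. x *s u + y *s v = 0 \<Longrightarrow> x = 0 \<and> y = 0"
    and eq: "x *s lift_vec F u + y *s lift_vec F v = x' *s lift_vec F u + y' *s lift_vec F v"
  shows "x = x' \<and> y = y'"
proof -
  obtain a b where ab: "x - x' = F a" "y - y' = F b"
    using galois_surj[OF F] by metis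
  have "(x - x') *s lift_vec F u + (y - y') *s lift_vec F v = 0"
    using eq by (simp add: vector_sub_rdistrib algebra_simps)
  then have "lift_vec F (a *s u + b *s v) = 0"
    by (simp add: lift_vec_galois[OF F] ab)
  then have "a *s u + b *s v = 0"
    using lift_vec_galois(3)[OF F] by blast
  then have "a = 0" "b = 0"
    using indep by auto
  then show ?thesis
    using ab galois_simps(5)[OF F] by simp
qed

end

section \<open>Conjugate extensions of the inverse field reduction\<close>

context cubic_field_reduction
begin

lemma inv_beta [simp]: "inv \<beta> (\<beta> x) = x" "\<beta> (inv \<beta> v) = v"
  using bij_beta by (simp_all add: bij_is_inj bij_is_surj surj_f_inv_f)

lemma inv_beta_add: "inv \<beta> (v + w) = inv \<beta> v + inv \<beta> w"
  by (metis beta_add inv_beta)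

lemma inv_beta_scale: "inv \<beta> (c *s v) = e c *s inv \<beta> v"
  by (metis beta_scale inv_beta)

lemma inv_beta_sum: "inv \<beta> (sum h A) = (\<Sum>i\<in>A. inv \<beta> (h i))"
proof (induction A rule: infinite_finite_induct)
  case (insert x A)
  then show ?case by (simp add: inv_beta_add)
qed (metis beta_0 inv_beta(1) sum.infinite sum.empty)+

text \<open>
  The \<open>\<F>\<^bsub>q^3\<^esub>\<close>-linear extension of the \<open>\<F>\<^sub>q\<close>-linear map \<open>F \<circ> \<beta>\<^sup>-\<^sup>1\<close>. Each of the three conjugate
  indicator lines lies in the kernels of two of these maps, for \<open>F\<close> in \<open>galois\<close>.
\<close>

definition pullback :: "('k \<Rightarrow> 'k) \<Rightarrow> 'k^'m \<Rightarrow> 'k^'r" where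
  "pullback F w = (\<Sum>i\<in>UNIV. w $ i *s lift_vec F (inv \<beta> (axis i 1)))"

lemma pullback_add: "pullback F (v + w) = pullback F v + pullback F w"
  by (simp add: pullback_def vector_sadd_rdistrib sum.distrib)

lemma pullback_scale: "pullback F (c *s w) = c *s pullback F w"
  by (simp add: pullback_def vec.scale_sum_right vector_smult_assoc)

lemma pullback_lift_vec:
  assumes F: "F \<in> galois"
  shows "pullback F (lift_vec e v) = lift_vec F (inv \<beta> v)"
proof -
  have sum: "lift_vec F (sum h A) = (\<Sum>i\<in>A. lift_vec F (h i))" for h :: "'m \<Rightarrow> 'k^'r" and A
    by (induction A rule: infinite_finite_induct) (simp_all add: lift_vec_galois[OF F])
  have "inv \<beta> v = inv \<beta> (\<Sum>i\<in>UNIV. v $ i *s axis i 1)"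
    by (simp add: basis_expansion)
  also have "\<dots> = (\<Sum>i\<in>UNIV. e (v $ i) *s inv \<beta> (axis i 1))"
    by (simp add: inv_beta_sum inv_beta_scale)
  finally show ?thesis
    by (simp add: sum lift_vec_galois[OF F] galois_simps[OF F] pullback_def)
      (simp add: lift_vec_def)
qed

text \<open>The extended spread element of \<open>x\<close> is generated by lifts of
  \<open>\<beta> (a *s x)\<close>, and each of them goes to a multiple of the conjugate of
  \<open>x\<close>.\<close>

lemma pullback_ext:
  assumes F: "F \<in> galois" and w: "w \<in> ext e (\<beta> ` vec.span {x})"
  obtains c where "pullback F w = c *s lift_vec F x"
proof -
  have "pullback F w \<in> vec.span {lift_vec F x}"
    using w unfolding ext_def
  proof (induction rule: vec.span_induct_alt)
    case base
    show ?case
      using pullback_scale[of F 0 0] by (simp add: vec.span_zero)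
  next
    case (step c v w)
    then obtain a where "v = lift_vec e (\<beta> (a *s x))"
      by (auto simp: vec.span_singleton)
    then have "pullback F v = F a *s lift_vec F x"
      by (simp add: pullback_lift_vec[OF F] lift_vec_galois[OF F])
    then show ?case
      using step by (simp add: pullback_add pullback_scale vec.span_add vec.span_scale vec.span_base)
  qed
  then show ?thesis
    using that by (auto simp: vec.span_singleton)
qed

text \<open>
  A line of the extension that meets all extended spread elements is the eigenspace of one
  conjugation, so all but one of the maps \<^term>\<open>pullback F\<close> vanish on it: otherwise two
  conjugations would agree up to a projectivity fixing three points.
\<close>

lemma pullback_transversal:
  assumes indep: "\<And>x y. x *s u + y *s v = 0 \<Longrightarrow> x = 0 \<and> y = 0"
    and \<nu>: "vec.subspace \<nu>" "vec.dim \<nu> = 2"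
    and meet: "\<And>x. x \<in> vec.span {u, v} \<Longrightarrow> x \<noteq> 0 \<Longrightarrow> \<exists>w. w \<in> \<nu> \<and> w \<noteq> 0 \<and> w \<in> ext e (\<beta> ` vec.span {x})"
    and FG: "F \<in> galois" "G \<in> galois" "F \<noteq> G"
  shows "(\<forall>w\<in>\<nu>. pullback F w = 0) \<or> (\<forall>w\<in>\<nu>. pullback G w = 0)"
proof -
  \<comment> \<open>\<open>c\<close> serves as cross-ratio of the points \<open>u\<close>,
    \<open>v\<close>, \<open>u + v\<close>, \<open>u + c *s v\<close>; since \<open>frob\<close>
    moves it, it tells the conjugations apart.\<close>
  obtain c where c: "frob c \<noteq> c"
    using exists_not_frob_fixed by blast
  then have "c \<noteq> 0"
    by auto
  let ?E = "\<lambda>x. ext e (\<beta> ` vec.span {x})"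
  have disj: "?E x \<inter> ?E y \<subseteq> {0}" if "vec.span {x} \<inter> vec.span {y} \<subseteq> {0}" for x y
  proof (rule ext_inter_trivial)
    show "\<beta> ` vec.span {x} \<inter> \<beta> ` vec.span {y} \<subseteq> {0}"
      using that by auto
  qed (simp_all add: subspace_beta)
  have disj_uv: "vec.span {a *s u + b *s v} \<inter> vec.span {a' *s u + b' *s v} \<subseteq> {0}"
    if "a * b' \<noteq> a' * b" for a b a' b'
  proof -
    have False if eq: "s *s (a *s u + b *s v) = t *s (a' *s u + b' *s v)"
      and nz: "s *s (a *s u + b *s v) \<noteq> 0" for s t
    proof -
      have "(s * a - t * a') *s u + (s * b - t * b') *s v = 0"
        using eq by (simp add: vector_add_ldistrib vector_smult_assoc vector_sub_rdistrib algebra_simps)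
      then have "s * a = t * a'" "s * b = t * b'"
        using indep by fastforce+
      then have "s * (a * b' - a' * b) = 0"
        by algebra
      then have "s = 0"
        using \<open>a * b' \<noteq> a' * b\<close> by simp
      with nz show False by simp
    qed
    then show ?thesis
      unfolding vec.span_singleton by blast
  qed
  have mem: "a *s u + b *s v \<in> vec.span {u, v}" for a b
    by (auto simp: mem_span_two)
  have nz: "a *s u + b *s v \<noteq> 0" if "a \<noteq> 0 \<or> b \<noteq> 0" for a b
    using indep that by blast
  have ex: "\<exists>w. w \<in> \<nu> \<and> w \<noteq> 0 \<and> w \<in> ?E (a *s u + b *s v)" if "a \<noteq> 0 \<or> b \<noteq> 0" for a b
    using meet[OF mem nz[OF that]] .
  obtain wu where wu: "wu \<in> \<nu>" "wu \<noteq> 0" "wu \<in> ?E u"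
    using ex[of 1 0] by auto
  obtain wv where wv: "wv \<in> \<nu>" "wv \<noteq> 0" "wv \<in> ?E v"
    using ex[of 0 1] by auto
  obtain w1 where w1: "w1 \<in> \<nu>" "w1 \<noteq> 0" "w1 \<in> ?E (u + v)"
    using ex[of 1 1] by auto
  obtain wc where wc: "wc \<in> \<nu>" "wc \<noteq> 0" "wc \<in> ?E (u + c *s v)"
    using ex[of 1 c] by auto
  have E_scale: "a *s w \<in> ?E x" if "w \<in> ?E x" for a w x
    using that by (simp add: ext_def vec.span_scale)
  have "wu \<notin> vec.span {wv}"
  proof
    assume "wu \<in> vec.span {wv}"
    then have "wu \<in> ?E v"
      using E_scale[OF wv(3)] by (auto simp: vec.span_singleton)
    then show False
      using disj[of u v] disj_uv[of 1 1 0 0] wu by auto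
  qed
  then have "vec.dim (vec.span {wu, wv}) = 2"
    using wv(2) by (simp add: vec.dim_insert)
  moreover have "vec.span {wu, wv} \<subseteq> \<nu>"
    using \<nu>(1) wu(1) wv(1) by (simp add: vec.span_minimal)
  ultimately have "vec.span {wu, wv} = \<nu>"
    using \<nu> by (intro vec.subspace_dim_equal) auto
  then have \<nu>_eq: "\<exists>a b. x = a *s wu + b *s wv" if "x \<in> \<nu>" for x
    using that by (auto simp: mem_span_two)
  obtain a b where ab: "w1 = a *s wu + b *s wv"
    using \<nu>_eq w1 by blast
  obtain a' b' where ab': "wc = a' *s wu + b' *s wv"
    using \<nu>_eq wc by blast
  have "a \<noteq> 0"
    using disj[of "u + v" v] disj_uv[of 1 1 0 1] w1 E_scale[OF wv(3), of b] by (auto simp: ab)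
  have "b \<noteq> 0"
    using disj[of "u + v" u] disj_uv[of 1 0 1 1] w1 E_scale[OF wu(3), of a] by (auto simp: ab)
  have "a' \<noteq> 0"
    using disj[of "u + c *s v" v] disj_uv[of 1 1 0 c] wc E_scale[OF wv(3), of b'] by (auto simp: ab')
  \<comment> \<open>If \<open>pullback F\<close> does not vanish on \<nu>, it preserves the
    cross-ratio, so \<open>F c\<close> is an expression in coordinates on \<nu> that does not depend
    on \<open>F\<close>.\<close>
  have key: "F c = b' * a / (b * a')" if F: "F \<in> galois" and "\<not> (\<forall>w\<in>\<nu>. pullback F w = 0)" for F
  proof -
    obtain l where l: "pullback F wu = l *s lift_vec F u"
      using pullback_ext[OF F wu(3)] .
    obtain m where m: "pullback F wv = m *s lift_vec F v"
      using pullback_ext[OF F wv(3)] .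
    obtain n where "pullback F w1 = n *s lift_vec F (u + v)"
      using pullback_ext[OF F w1(3)] .
    then have "(a * l) *s lift_vec F u + (b * m) *s lift_vec F v
        = n *s lift_vec F u + n *s lift_vec F v"
      by (simp add: ab pullback_add pullback_scale l m lift_vec_galois[OF F] vector_smult_assoc vector_add_ldistrib)
    from lift_vec_galois_independent[OF F indep this] have 1: "a * l = b * m"
      by simp
    obtain k where "pullback F wc = k *s lift_vec F (u + c *s v)"
      using pullback_ext[OF F wc(3)] .
    then have "(a' * l) *s lift_vec F u + (b' * m) *s lift_vec F v
        = k *s lift_vec F u + (k * F c) *s lift_vec F v"
      by (simp add: ab' pullback_add pullback_scale l m lift_vec_galois[OF F] vector_smult_assoc vector_add_ldistrib)
    from lift_vec_galois_independent[OF F indep this] have 2: "b' * m = a' * l * F c"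
      by simp
    have "l \<noteq> 0"
    proof
      assume "l = 0"
      then have "pullback F wu = 0" "pullback F wv = 0"
        using 1 \<open>b \<noteq> 0\<close> l m by auto
      then have "\<forall>w\<in>\<nu>. pullback F w = 0"
        using \<nu>_eq by (metis add_0 pullback_add pullback_scale vector_smult_rzero)
      with that(2) show False ..
    qed
    have "l * (F c * (b * a')) = l * (b' * a)"
      using 1 2 by algebra
    then show ?thesis
      using \<open>l \<noteq> 0\<close> \<open>b \<noteq> 0\<close> \<open>a' \<noteq> 0\<close> by (simp add: field_simps)
  qed
  show ?thesis
    using key[of F] key[of G] galois_neq[OF c FG] FG by metis
qed

end

section \<open>Coordinates in the Andre/Bruck-Bose setting\<close>

lemma pg_point_span: "x \<noteq> 0 \<Longrightarrow> pg_point (vec.span {x})"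
  by (simp add: proj_sub_def)

lemma pg_point_eq_span:
  assumes "pg_point P" "x \<in> P" "x \<noteq> 0"
  shows "P = vec.span {x}"
  using assms vec.subspace_dim_equal[of "vec.span {x}" P]
  by (auto simp: proj_sub_def vec.span_minimal)

lemma pg_point_obtains:
  assumes "pg_point P"
  obtains x where "x \<noteq> 0" "P = vec.span {x}"
proof -
  have "\<not> P \<subseteq> {0}"
    using assms vec.dim_eq_0[of P] by (simp add: proj_sub_def)
  then obtain x where "x \<in> P" "x \<noteq> 0"
    by blast
  then show ?thesis
    using that pg_point_eq_span[OF assms] by blast
qed

lemma independent_pair:
  fixes u v :: "'a::field^'n"
  assumes "u \<notin> vec.span {v}" "v \<noteq> 0" "x *s u + y *s v = 0"
  shows "x = 0 \<and> y = 0"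
proof -
  have "x = 0"
  proof (rule ccontr)
    assume "x \<noteq> 0"
    have "x *s u = - (y *s v)"
      using assms(3) by (simp add: eq_neg_iff_add_eq_0)
    then have "x *s u \<in> vec.span {v}"
      by (simp add: vec.span_neg vec.span_scale vec.span_base)
    then have "inverse x *s (x *s u) \<in> vec.span {v}"
      by (rule vec.span_scale)
    moreover have "inverse x *s (x *s u) = u"
      using \<open>x \<noteq> 0\<close> by (simp only: vector_smult_assoc) simp
    ultimately show False
      using assms(1) by simp
  qed
  with assms show ?thesis
    by simp
qed

lemma vector_4 [simp]:
  "(vector [x, y, z, w] :: 'a::zero^4) $ 1 = x"
  "(vector [x, y, z, w] :: 'a::zero^4) $ 2 = y"
  "(vector [x, y, z, w] :: 'a::zero^4) $ 3 = z"
  "(vector [x, y, z, w] :: 'a::zero^4) $ 4 = w"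
  unfolding vector_def by simp_all

lemma matrix_vector_mult_4:
  "B *v vector [x, y, z, w]
     = x *s column 1 B + y *s column 2 B + z *s column 3 B + w *s column 4 (B :: 'a::field^4^'m)"
  by (simp add: matrix_mult_sum sum_4)

context cubic_field_reduction
begin

text \<open>The extended spread element of \<open>x\<close> lies in the span of a point of \<nu> and
  its images under \<sigma>. This span has dimension at most 3 and the extension has dimension 3, so
  they coincide and the point lies in the extension.\<close>

lemma indicator_line_meets:
  assumes fixed: "fixes_subgeometry e (\<beta> ` l) \<sigma>"
    and ind: "indicator_line e (\<beta> ` l) (desarguesian_spread \<beta> l) \<sigma> \<nu>"
    and l: "vec.subspace l" and x: "x \<in> l" "x \<noteq> 0"
  obtains w where "w \<in> \<nu>" "w \<noteq> 0" "w \<in> ext e (\<beta> ` vec.span {x})"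
proof -
  let ?S = "\<beta> ` vec.span {x}" and ?H = "ext e (\<beta> ` l)"
  have "?S \<in> desarguesian_spread \<beta> l"
    using x l pg_point_span[OF x(2)] vec.span_minimal[of "{x}" l]
    unfolding desarguesian_spread_def by blast
  then obtain P where P: "pg_point P" "P \<subseteq> \<nu>"
      "?S = subgeometry_part e (\<beta> ` l) (vec.span (\<Union>(conjugate_points \<sigma> P)))"
    using ind unfolding indicator_line_def by blast
  obtain w where w: "w \<noteq> 0" "P = vec.span {w}"
    using pg_point_obtains[OF P(1)] .
  have "P \<subseteq> ?H"
    using ind P(2) by (auto simp: indicator_line_def)
  then have wH: "w \<in> ?H"
    using w(2) vec.span_base[of w "{w}"] by auto
  have coll: "collineation ?H \<sigma>"
    using fixed by (simp add: fixes_subgeometry_def)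
  then obtain \<tau> where \<tau>: "\<forall>c. \<forall>x\<in>?H. \<sigma> (c *s x) = \<tau> c *s \<sigma> x"
    unfolding collineation_def by blast
  have image: "\<sigma> ` A \<subseteq> vec.span {\<sigma> y}" if A: "A \<subseteq> vec.span {y}" and y: "y \<in> ?H" for A y
  proof (rule image_subsetI)
    fix z assume "z \<in> A"
    then obtain c where "z = c *s y"
      using A by (auto simp: vec.span_singleton)
    then show "\<sigma> z \<in> vec.span {\<sigma> y}"
      using \<tau> y by (simp add: vec.span_scale vec.span_base)
  qed
  have \<sigma>H: "\<sigma> y \<in> ?H" if "y \<in> ?H" for y
    using coll that by (auto simp: collineation_def bij_betw_def)
  let ?E = "vec.span {w, \<sigma> w, \<sigma> (\<sigma> w)}"
  have 1: "\<sigma> ` P \<subseteq> vec.span {\<sigma> w}"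
    using image[of P w] w(2) wH by simp
  have 2: "\<sigma> ` \<sigma> ` P \<subseteq> vec.span {\<sigma> (\<sigma> w)}"
    using image[OF 1 \<sigma>H[OF wH]] .
  have "vec.span {w} \<subseteq> ?E" "vec.span {\<sigma> w} \<subseteq> ?E" "vec.span {\<sigma> (\<sigma> w)} \<subseteq> ?E"
    by (simp_all add: vec.span_minimal vec.span_base)
  then have "P \<subseteq> ?E" "\<sigma> ` P \<subseteq> ?E" "\<sigma> ` \<sigma> ` P \<subseteq> ?E"
    using 1 2 w(2) by (simp, meson order_trans, meson order_trans)
  then have "\<Union>(conjugate_points \<sigma> P) \<subseteq> ?E"
    by (simp only: conjugate_points_def Union_insert Un_subset_iff Union_empty empty_subsetI simp_thms)
  then have E: "vec.span (\<Union>(conjugate_points \<sigma> P)) \<subseteq> ?E"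
    by (simp add: vec.span_minimal)
  have "lift_vec e ` ?S \<subseteq> vec.span (\<Union>(conjugate_points \<sigma> P))"
    unfolding P(3) by (auto simp: subgeometry_part_def)
  then have "ext e ?S \<subseteq> ?E"
    using E unfolding ext_def by (meson order_trans vec.span_minimal vec.subspace_span)
  moreover have "vec.dim ?E \<le> vec.dim (ext e ?S)"
  proof -
    have "vec.dim ?E \<le> card {w, \<sigma> w, \<sigma> (\<sigma> w)}"
      by (rule vec.dim_le_card) auto
    also have "\<dots> \<le> 3"
      using card_insert_le_m1[of 3 "{\<sigma> w, \<sigma> (\<sigma> w)}" w] card_insert_le_m1[of 2 "{\<sigma> (\<sigma> w)}" "\<sigma> w"] by simp
    also have "3 = vec.dim (ext e ?S)"
      using x(2) dim_ext[OF subspace_beta[OF vec.subspace_span], of "{x}"] by (simp add: dim_beta)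
    finally show ?thesis .
  qed
  ultimately have "ext e ?S = ?E"
    by (intro vec.subspace_dim_equal) (auto simp: ext_def)
  then have "w \<in> ext e ?S"
    by (simp add: vec.span_base)
  moreover have "w \<in> \<nu>"
    using P(2) w(2) vec.span_base[of w "{w}"] by auto
  ultimately show ?thesis
    using that w(1) by blast
qed

end

lemma (in cubic_extension) conjugate_power:
  assumes "i \<in> {0, 1, 2 :: nat}"
  shows "\<omega> ^ (CARD('f) ^ i) \<in> {\<omega>, frob \<omega>, frob (frob \<omega>)}"
    and "\<omega> ^ (2 * CARD('f) ^ i) = (\<omega> ^ (CARD('f) ^ i))\<^sup>2"
proof -
  show "\<omega> ^ (CARD('f) ^ i) \<in> {\<omega>, frob \<omega>, frob (frob \<omega>)}"
    using assms by (auto simp: frob_def power2_eq_square simp flip: power_mult)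
  show "\<omega> ^ (2 * CARD('f) ^ i) = (\<omega> ^ (CARD('f) ^ i))\<^sup>2"
    by (metis mult.commute power_mult)
qed

section \<open>The frame determined by the chosen coordinates\<close>

locale abb = cubic_field_reduction e \<beta>
  for e :: "'f::{field,finite} \<Rightarrow> 'k::{field,finite}" and \<beta> :: "'k^3 \<Rightarrow> 'f^9" +
  fixes L l_inf P_inf :: "('k^3) set" and \<mu> :: "('f^9) set" and \<sigma> :: "'k^9 \<Rightarrow> 'k^9"
    and \<nu> :: "('k^9) set" and \<omega> :: 'k and B :: "'f^4^9"
  assumes setting: "abb_setting e \<beta> L l_inf P_inf \<mu>"
    and stabiliser: "generates_pointwise_stabiliser e (\<beta> ` l_inf) \<sigma>"
    and indicator: "indicator_line e (\<beta> ` l_inf) (desarguesian_spread \<beta> l_inf) \<sigma> \<nu>"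
    and coordinates: "abb_coordinates e \<beta> L P_inf \<mu> \<sigma> \<nu> \<omega> B"
begin

text \<open>\<nu> meets every extended spread element. Over the three pairs this leaves at most one
  conjugation that does not vanish on \<nu>.\<close>

lemma two_conjugations_vanish:
  assumes "F \<in> galois" "G \<in> galois" "F \<noteq> G"
  shows "(\<forall>w\<in>\<nu>. pullback F w = 0) \<or> (\<forall>w\<in>\<nu>. pullback G w = 0)"
proof -
  have l: "vec.subspace l_inf" "vec.dim l_inf = 2"
    using setting by (auto simp: abb_setting_def proj_sub_def)
  obtain A where A: "A \<subseteq> l_inf" "vec.independent A" "l_inf \<subseteq> vec.span A" "card A = 2"
    using vec.basis_exists[of l_inf] l(2) by metis
  then obtain u v where uv: "A = {u, v}" "u \<noteq> v"
    by (auto simp: card_2_iff)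
  have "u \<notin> vec.span {v}" "v \<noteq> 0"
    using A(2) uv by (auto simp: vec.independent_insert)
  have sub: "vec.span {u, v} \<subseteq> l_inf"
    using A(1) l(1) uv by (simp add: vec.span_minimal)
  show ?thesis
  proof (rule pullback_transversal[OF independent_pair _ _ _ assms])
    show "u \<notin> vec.span {v}" "v \<noteq> 0"
      by fact+
    show "vec.subspace \<nu>" "vec.dim \<nu> = 2"
      using indicator by (auto simp: indicator_line_def proj_sub_def)
    fix x assume "x \<in> vec.span {u, v}" "x \<noteq> 0"
    then show "\<exists>w. w \<in> \<nu> \<and> w \<noteq> 0 \<and> w \<in> ext e (\<beta> ` vec.span {x})"
      using indicator_line_meets[OF _ indicator l(1)] stabiliser sub
      unfolding generates_pointwise_stabiliser_def by (metis subsetD)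
  qed
qed

text \<open>
  The coordinates identify \<^term>\<open>\<beta> ` P_inf\<close> with the cubic extension in such a way that the
  conjugate points are the common zeros of two of the three conjugates of the identification,
  which determines it up to a scalar.
\<close>

lemma abb_frame:
  assumes \<omega>: "frob \<omega> \<noteq> \<omega>"
  obtains g p \<theta> where "P_inf = vec.span {p}" "L = vec.span {g, p}"
    "\<And>x y. x *s g + y *s p = 0 \<Longrightarrow> x = 0 \<and> y = 0"
    "\<theta> \<in> {\<omega>, frob \<omega>, frob (frob \<omega>)}"
    "\<And>x y z w. B *v vector [x, y, z, w] = \<beta> (e w *s g + affine_param \<theta> x y z *s p)"
proof -
  have inj: "inj ((*v) B)" and range: "range ((*v) B) = \<beta> ` L \<inter> \<mu>"
    and infinity: "(*v) B ` {X. X $ 4 = 0} = \<beta> ` P_inf"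
    and conj: "{vec.span {map_matrix e B *v vector [1, \<omega> ^ (CARD('f) ^ i), \<omega> ^ (2 * CARD('f) ^ i), 0]} |i.
        i \<in> {0, 1, 2}} = conjugate_points \<sigma> (\<nu> \<inter> ext e (\<beta> ` P_inf))"
    using coordinates by (auto simp: abb_coordinates_def)
  obtain p where p: "p \<noteq> 0" "P_inf = vec.span {p}"
    using setting pg_point_obtains[of P_inf] by (auto simp: abb_setting_def)
  have col: "\<exists>t. B *v X = \<beta> (t *s p)" if "X $ 4 = 0" for X :: "'f^4"
  proof -
    have "B *v X \<in> \<beta> ` P_inf"
      using that unfolding infinity[symmetric] by simp
    then show ?thesis
      by (auto simp: p(2) vec.span_singleton)
  qed
  obtain t1 where t1: "column 1 B = \<beta> (t1 *s p)"
    using col[of "vector [1, 0, 0, 0]"] by (auto simp: matrix_vector_mult_4)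
  obtain t2 where t2: "column 2 B = \<beta> (t2 *s p)"
    using col[of "vector [0, 1, 0, 0]"] by (auto simp: matrix_vector_mult_4)
  obtain t3 where t3: "column 3 B = \<beta> (t3 *s p)"
    using col[of "vector [0, 0, 1, 0]"] by (auto simp: matrix_vector_mult_4)
  define g where "g = inv \<beta> (column 4 B)"
  then have g: "column 4 B = \<beta> g"
    by simp
  have Bg: "B *v vector [0, 0, 0, 1] = \<beta> g"
    by (simp add: matrix_vector_mult_4 g)
  \<comment> \<open>The point of \<nu> over \<open>P_inf\<close> is one of the three listed points,
    but it is unknown which; \<eta> records the choice.\<close>
  obtain \<eta> where \<eta>: "\<eta> \<in> {\<omega>, frob \<omega>, frob (frob \<omega>)}"
    "map_matrix e B *v vector [1, \<eta>, \<eta>\<^sup>2, 0] \<in> \<nu>"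
  proof -
    have "\<nu> \<inter> ext e (\<beta> ` P_inf) \<in> conjugate_points \<sigma> (\<nu> \<inter> ext e (\<beta> ` P_inf))"
      by (simp add: conjugate_points_def)
    then obtain i where i: "i \<in> {0, 1, 2 :: nat}" "\<nu> \<inter> ext e (\<beta> ` P_inf)
        = vec.span {map_matrix e B *v vector [1, \<omega> ^ (CARD('f) ^ i), \<omega> ^ (2 * CARD('f) ^ i), 0]}"
      unfolding conj[symmetric] by blast
    then have "map_matrix e B *v vector [1, \<omega> ^ (CARD('f) ^ i), \<omega> ^ (2 * CARD('f) ^ i), 0] \<in> \<nu>"
      using vec.span_base by blast
    then show ?thesis
      using that conjugate_power[OF i(1), of \<omega>] by metis
  qed
  have column_map: "column i (map_matrix e B) = lift_vec e (column i B)" for i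
    by (simp add: column_def lift_vec_def map_matrix_def vec_eq_iff)
  have pull: "pullback F (map_matrix e B *v vector [1, \<eta>, \<eta>\<^sup>2, 0])
      = (F t1 + \<eta> * F t2 + \<eta>\<^sup>2 * F t3) *s lift_vec F p" if "F \<in> galois" for F
    by (simp add: matrix_vector_mult_4 column_map t1 t2 t3 pullback_add pullback_scale
        pullback_lift_vec[OF that] lift_vec_galois[OF that] vector_smult_assoc vector_sadd_rdistrib)
  have eq: "F t1 + \<eta> * F t2 + \<eta>\<^sup>2 * F t3 = 0"
    if "F \<in> galois" "\<forall>w\<in>\<nu>. pullback F w = 0" for F
  proof -
    have "(F t1 + \<eta> * F t2 + \<eta>\<^sup>2 * F t3) *s lift_vec F p = 0"
      using that(2) \<eta>(2) unfolding pull[OF that(1), symmetric] by blast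
    then show ?thesis
      using p(1) lift_vec_galois(3)[OF that(1), of p] unfolding vec.scale_eq_0_iff by blast
  qed
  have gal: "(\<lambda>x. x) \<in> galois" "frob \<in> galois" "(\<lambda>x. frob (frob x)) \<in> galois"
    by (auto simp: galois_def)
  have "frob \<eta> \<noteq> \<eta>"
    using \<eta>(1) \<omega> frob_neq[OF \<omega>] by auto
  note \<eta>_neq = frob_neq[OF this]
  have distinct: "(\<lambda>x. x) \<noteq> frob" "(\<lambda>x. x) \<noteq> (\<lambda>x. frob (frob x))" "frob \<noteq> (\<lambda>x. frob (frob x))"
    using \<eta>_neq by (auto simp: fun_eq_iff)
  \<comment> \<open>Undoing the conjugation moves it from the \<open>t1\<close>, \<open>t2\<close>,
    \<open>t3\<close> to \<eta>, so every vanishing conjugation yields a root of one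
    quadratic.\<close>
  let ?Z = "\<lambda>\<zeta>. t1 + \<zeta> * t2 + \<zeta>\<^sup>2 * t3 = 0"
  have Z0: "?Z \<eta>" if "\<forall>w\<in>\<nu>. pullback (\<lambda>x. x) w = 0"
    using eq[OF gal(1) that] .
  have Z1: "?Z (frob (frob \<eta>))" if "\<forall>w\<in>\<nu>. pullback frob w = 0"
  proof -
    have "frob (frob (frob t1 + \<eta> * frob t2 + \<eta>\<^sup>2 * frob t3)) = 0"
      using eq[OF gal(2) that] by simp
    then show ?thesis
      by (simp only: frob_add frob_mult frob_power frob_frob_frob)
  qed
  have Z2: "?Z (frob \<eta>)" if "\<forall>w\<in>\<nu>. pullback (\<lambda>x. frob (frob x)) w = 0"
  proof -
    have "frob (frob (frob t1) + \<eta> * frob (frob t2) + \<eta>\<^sup>2 * frob (frob t3)) = 0"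
      using eq[OF gal(3) that] by simp
    then show ?thesis
      by (simp only: frob_add frob_mult frob_power frob_frob_frob)
  qed
  \<comment> \<open>At least two conjugates of \<eta> are roots; \<theta> is the remaining
    one.\<close>
  obtain \<theta> where \<theta>: "\<theta> \<in> {\<eta>, frob \<eta>, frob (frob \<eta>)}" "?Z (frob \<theta>)" "?Z (frob (frob \<theta>))"
    using two_conjugations_vanish[OF gal(1,2) distinct(1)] two_conjugations_vanish[OF gal(1,3) distinct(2)]
      two_conjugations_vanish[OF gal(2,3) distinct(3)] Z0 Z1 Z2
    by (metis frob_frob_frob insertCI)
  have "frob \<theta> \<noteq> \<theta>"
    using \<theta>(1) \<open>frob \<eta> \<noteq> \<eta>\<close> \<eta>_neq by auto
  note \<theta>_neq = frob_neq[OF this]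
  \<comment> \<open>Vieta for the quadratic: up to the factor \<open>t3\<close>, later absorbed into
    \<open>p'\<close>, its coefficients are those of \<open>affine_param \<theta>\<close>.\<close>
  have "(frob \<theta> - frob (frob \<theta>)) * (t2 + (frob \<theta> + frob (frob \<theta>)) * t3) = 0"
    using \<theta>(2,3) by algebra
  then have t2_eq: "t2 = - ((frob \<theta> + frob (frob \<theta>)) * t3)"
    using \<theta>_neq by (simp add: eq_neg_iff_add_eq_0)
  then have t1_eq: "t1 = frob \<theta> * frob (frob \<theta>) * t3"
    using \<theta>(2) by algebra
  have B_eq: "B *v vector [x, y, z, w] = \<beta> (e w *s g + affine_param \<theta> x y z *s (t3 *s p))" for x y z w
    by (simp add: matrix_vector_mult_4 t1 t2 t3 g t1_eq t2_eq affine_param_def flip: beta_scale beta_add)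
      (simp add: vec_eq_iff algebra_simps)
  have "t3 \<noteq> 0"
  proof
    assume "t3 = 0"
    then have "B *v vector [1, 0, 0, 0] = B *v vector [0, 0, 0, 0]"
      unfolding B_eq by simp
    then have "(vector [1, 0, 0, 0] :: 'f^4) $ 1 = (vector [0, 0, 0, 0] :: 'f^4) $ 1"
      using inj by (metis injD)
    then show False by simp
  qed
  define p' where "p' = t3 *s p"
  have "p' \<noteq> 0"
    using \<open>t3 \<noteq> 0\<close> p(1) by (simp add: p'_def)
  moreover have "p' \<in> P_inf"
    by (auto simp: p(2) p'_def vec.span_singleton)
  ultimately have P_inf: "P_inf = vec.span {p'}"
    using setting by (intro pg_point_eq_span) (auto simp: abb_setting_def)
  have "g \<notin> P_inf"
  proof
    assume "g \<in> P_inf"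
    then have "B *v vector [0, 0, 0, 1] \<in> (*v) B ` {X. X $ 4 = 0}"
      unfolding infinity by (simp add: Bg)
    then have "(vector [0, 0, 0, 1] :: 'f^4) \<in> {X. X $ 4 = 0}"
      using inj by (simp only: inj_image_mem_iff)
    then show False
      by simp
  qed
  have indep: "x = 0 \<and> y = 0" if "x *s g + y *s p' = 0" for x y
    using independent_pair[OF _ \<open>p' \<noteq> 0\<close> that] \<open>g \<notin> P_inf\<close> P_inf by simp
  have "L = vec.span {g, p'}"
  proof (rule vec.subspace_dim_equal[symmetric])
    have "\<beta> g \<in> \<beta> ` L"
      using range Bg by (metis IntE rangeI)
    moreover have "p' \<in> L"
      using \<open>p' \<in> P_inf\<close> setting by (auto simp: abb_setting_def)
    ultimately show "vec.span {g, p'} \<subseteq> L"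
      using setting by (intro vec.span_minimal) (auto simp: abb_setting_def proj_sub_def)
    have "vec.dim (vec.span {g, p'}) = 2"
      using \<open>g \<notin> P_inf\<close> \<open>p' \<noteq> 0\<close> by (simp add: vec.dim_insert P_inf)
    then show "vec.dim L \<le> vec.dim (vec.span {g, p'})"
      using setting by (simp add: abb_setting_def proj_sub_def)
  qed (use setting in \<open>auto simp: abb_setting_def proj_sub_def\<close>)
  moreover have "\<theta> \<in> {\<omega>, frob \<omega>, frob (frob \<omega>)}"
    using \<theta>(1) \<eta>(1) by auto
  ultimately show ?thesis
    using that P_inf indep B_eq unfolding p'_def by blast
qed

end

section \<open>The map \<phi> and its inverse on affine points\<close>

context abb
begin

lemma subspaces [simp]:
  "vec.subspace L" "vec.subspace l_inf" "vec.subspace \<mu>"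
  "vec.dim L = 2" "vec.dim l_inf = 2" "vec.dim \<mu> = 7" "\<beta> ` l_inf \<subseteq> \<mu>"
  using setting by (auto simp: abb_setting_def proj_sub_def)

text \<open>The plane of an affine point is disjoint from the image of \<open>l_inf\<close>, which
  has vector dimension 6 in the 7-dimensional \<mu>; so at most dimension 1 of it lies in
  \<mu>.\<close>

lemma abb_map_affine_point:
  assumes "x \<notin> l_inf" "m \<in> abb_map \<beta> \<mu> (vec.span {x})" "m \<noteq> 0"
  shows "abb_map \<beta> \<mu> (vec.span {x}) = vec.span {m}"
proof -
  let ?P = "\<beta> ` vec.span {x}"
  have "x \<noteq> 0"
    using assms(1) vec.subspace_0[of l_inf] by auto
  have "z = 0" if "z \<in> l_inf" and z: "z \<in> vec.span {x}" for z
  proof -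
    obtain c where c: "z = c *s x"
      using z by (auto simp: vec.span_singleton)
    have "c = 0"
    proof (rule ccontr)
      assume "c \<noteq> 0"
      have "inverse c *s z \<in> l_inf"
        using \<open>z \<in> l_inf\<close> by (simp add: vec.subspace_scale)
      moreover have "inverse c *s z = x"
        using \<open>c \<noteq> 0\<close> unfolding c by (simp only: vector_smult_assoc) simp
      ultimately show False
        using assms(1) by simp
    qed
    then show "z = 0"
      by (simp add: c)
  qed
  then have "\<beta> ` l_inf \<inter> (?P \<inter> \<mu>) \<subseteq> {0}"
    by auto
  then have "vec.dim (\<beta> ` l_inf \<inter> (?P \<inter> \<mu>)) = 0"
    by simp
  moreover have sub: "vec.subspace (?P \<inter> \<mu>)" "vec.subspace (\<beta> ` l_inf)"
    by (simp_all add: vec.subspace_inter subspace_beta)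
  moreover have "{a + b |a b. a \<in> \<beta> ` l_inf \<and> b \<in> ?P \<inter> \<mu>} \<subseteq> \<mu>"
  proof -
    have "\<beta> y \<in> \<mu>" if "y \<in> l_inf" for y
      using subspaces(7) that by blast
    then show ?thesis
      by (auto intro!: vec.subspace_add)
  qed
  from vec.dim_subset[OF this] have "vec.dim {a + b |a b. a \<in> \<beta> ` l_inf \<and> b \<in> ?P \<inter> \<mu>} \<le> 7"
    by (simp only: subspaces)
  moreover have "vec.dim (\<beta> ` l_inf) = 6"
    by (simp add: dim_beta)
  ultimately have "vec.dim (?P \<inter> \<mu>) \<le> 1"
    using vec.dim_sums_Int[OF sub(2,1)] by linarith
  moreover have "vec.span {m} \<subseteq> ?P \<inter> \<mu>"
    using assms(2) sub(1) by (intro vec.span_minimal) (auto simp: abb_map_def)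
  ultimately show ?thesis
    using assms(3) sub(1) unfolding abb_map_def
    by (intro vec.subspace_dim_equal[symmetric]) simp_all
qed

text \<open>Vector dimensions 3 and 7 in dimension 9 give a nonzero vector of \<mu> over
  \<open>P\<close>, and one nonzero vector determines the point.\<close>

lemma inj_on_abb_map: "inj_on (abb_map \<beta> \<mu>) (affine_points L l_inf)"
proof (rule inj_onI)
  fix P Q
  assume P: "P \<in> affine_points L l_inf" and Q: "Q \<in> affine_points L l_inf"
    and eq: "abb_map \<beta> \<mu> P = abb_map \<beta> \<mu> Q"
  have "vec.dim (\<beta> ` P) = 3" "vec.subspace (\<beta> ` P)"
    using P by (simp_all add: affine_points_def proj_sub_def dim_beta subspace_beta)
  then obtain m where "m \<noteq> 0" "m \<in> \<beta> ` P" "m \<in> \<mu>"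
    using subspaces_meet[of "\<beta> ` P" \<mu> UNIV] by (auto simp: vec.dim_UNIV card_cart_basis)
  moreover from this eq have "m \<in> \<beta> ` Q"
    unfolding abb_map_def by blast
  ultimately obtain x where x: "x \<in> P" "x \<in> Q" "x \<noteq> 0"
    by auto
  then show "P = Q"
    using P Q pg_point_eq_span[of P x] pg_point_eq_span[of Q x] by (simp add: affine_points_def)
qed

lemma abb_inv_affine_point:
  assumes "x \<in> L" "x \<notin> l_inf" "\<beta> x \<in> \<mu>"
  shows "abb_inv \<beta> L l_inf \<mu> (vec.span {\<beta> x}) = vec.span {x}"
proof -
  have "x \<noteq> 0"
    using assms(2) vec.subspace_0[of l_inf] by auto
  then have "vec.span {x} \<in> affine_points L l_inf"
    using assms pg_point_span vec.span_base[of x "{x}"]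
    by (auto simp: affine_points_def vec.span_minimal)
  moreover have "abb_map \<beta> \<mu> (vec.span {x}) = vec.span {\<beta> x}"
    using \<open>x \<noteq> 0\<close> assms by (intro abb_map_affine_point) (auto simp: abb_map_def vec.span_base)
  ultimately show ?thesis
    unfolding abb_inv_def by (metis inj_on_abb_map the_inv_into_f_f)
qed

text \<open>Scaling the last coordinate to 1 yields the \<open>t\<close> for which the point is
  \<open>g + t *s p\<close>.\<close>

definition affine_value :: "'k \<Rightarrow> 'f list \<Rightarrow> 'k" where
  "affine_value \<theta> X = affine_param \<theta> (X ! 0) (X ! 1) (X ! 2) / e (X ! 3)"

text \<open>The frame fixes \<theta> only up to conjugation, so the condition on quadrics ranges
  over all three conjugates of \<omega>.\<close>

lemma higgledy_piggledy_plane_set: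
  assumes \<omega>: "frob \<omega> \<noteq> \<omega>"
    and pts: "\<And>X. X \<in> set pts \<Longrightarrow> length X = 4 \<and> X ! 3 \<noteq> 0" "pts \<noteq> []"
    and lineless: "\<And>\<theta>. \<theta> \<in> {\<omega>, frob \<omega>, frob (frob \<omega>)} \<Longrightarrow>
      only_lineless_quadrics (affine_value \<theta> ` set pts) \<and> card (affine_value \<theta> ` set pts) = n"
  shows "higgledy_piggledy 5 2 (\<beta> ` L) (plane_set \<beta> L l_inf P_inf \<mu> B pts)"
    and "card (plane_set \<beta> L l_inf P_inf \<mu> B pts) = Suc n"
proof -
  obtain g p \<theta> where P_inf: "P_inf = vec.span {p}" and L: "L = vec.span {g, p}"
    and indep: "\<And>x y. x *s g + y *s p = 0 \<Longrightarrow> x = 0 \<and> y = 0"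
    and \<theta>: "\<theta> \<in> {\<omega>, frob \<omega>, frob (frob \<omega>)}"
    and B: "\<And>x y z w. B *v vector [x, y, z, w] = \<beta> (e w *s g + affine_param \<theta> x y z *s p)"
    using abb_frame[OF \<omega>] by metis
  have p: "p \<in> l_inf"
    using setting P_inf vec.span_base[of p "{p}"] by (auto simp: abb_setting_def)
  have g: "g \<notin> l_inf"
  proof
    assume "g \<in> l_inf"
    then have "L \<subseteq> l_inf"
      using p unfolding L by (simp add: vec.span_minimal)
    then have "L = l_inf"
      by (intro vec.subspace_dim_equal) auto
    then show False
      using setting by (simp add: abb_setting_def)
  qed
  have range: "range ((*v) B) \<subseteq> \<mu>"
    using coordinates by (auto simp: abb_coordinates_def)
  have plane: "\<beta> ` abb_inv \<beta> L l_inf \<mu> (coord_point B X) = \<beta> ` vec.span {g + affine_value \<theta> X *s p}"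
    if "X \<in> set pts" for X
  proof -
    obtain x y z w where X: "X = [x, y, z, w]" "w \<noteq> 0"
      using pts(1)[OF \<open>X \<in> set pts\<close>] by (auto simp: length_Suc_conv numeral_eq_Suc)
    let ?v = "e w *s g + affine_param \<theta> x y z *s p" and ?v' = "g + affine_value \<theta> X *s p"
    have v: "?v = e w *s ?v'"
      using X by (simp add: affine_value_def vector_add_ldistrib vector_smult_assoc)
    have scale: "inverse (e w) *s ?v = ?v'"
      unfolding v using X(2) by (simp only: vector_smult_assoc) simp
    have "?v \<notin> l_inf"
    proof
      assume "?v \<in> l_inf"
      then have "?v' \<in> l_inf"
        unfolding scale[symmetric] by (rule vec.subspace_scale[OF subspaces(2)])
      then have "?v' - affine_value \<theta> X *s p \<in> l_inf"
        using p by (intro vec.subspace_diff vec.subspace_scale) auto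
      with g show False
        by simp
    qed
    moreover have "?v \<in> L"
      unfolding L mem_span_two by blast
    moreover have "\<beta> ?v \<in> \<mu>"
      using range unfolding B[symmetric] by blast
    ultimately have "abb_inv \<beta> L l_inf \<mu> (coord_point B X) = vec.span {?v}"
      unfolding coord_point_def X(1) B by (intro abb_inv_affine_point)
    also have "\<dots> = vec.span {?v'}"
    proof (rule antisym)
      show "vec.span {?v} \<subseteq> vec.span {?v'}"
        unfolding v by (intro vec.span_minimal)
          (simp_all only: insert_subset empty_subsetI vec.span_scale vec.span_base insertI1 simp_thms vec.subspace_span)
      have "inverse (e w) *s ?v \<in> vec.span {?v}"
        by (intro vec.span_scale vec.span_base) simp
      then show "vec.span {?v'} \<subseteq> vec.span {?v}"
        unfolding scale by (intro vec.span_minimal) auto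
    qed
    finally show ?thesis
      by simp
  qed
  have K: "plane_set \<beta> L l_inf P_inf \<mu> B pts = insert (\<beta> ` vec.span {p})
      ((\<lambda>t. \<beta> ` vec.span {g + t *s p}) ` (affine_value \<theta> ` set pts))"
    using plane unfolding plane_set_def P_inf image_image Setcompr_eq_image by auto
  have T: "only_lineless_quadrics (affine_value \<theta> ` set pts)" "affine_value \<theta> ` set pts \<noteq> {}"
    using lineless[OF \<theta>] pts(2) by auto
  show "higgledy_piggledy 5 2 (\<beta> ` L) (plane_set \<beta> L l_inf P_inf \<mu> B pts)"
    unfolding L[symmetric] using higgledy_piggledy_planes(1)[OF indep T K] by (simp add: L)
  show "card (plane_set \<beta> L l_inf P_inf \<mu> B pts) = Suc n"
    using higgledy_piggledy_planes(2)[OF indep T K] lineless[OF \<theta>] by simp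
qed

end

text \<open>A fixed root would come from \<open>'f\<close> and split off a linear factor
  there.\<close>

lemma (in cubic_extension) root_not_frob_fixed:
  fixes f :: "'f poly"
  assumes "irreducible f" "1 < degree f" "poly (map_poly e f) \<omega> = 0"
  shows "frob \<omega> \<noteq> \<omega>"
proof
  assume "frob \<omega> = \<omega>"
  then obtain x where \<omega>: "\<omega> = e x"
    using frob_fixed_iff by auto
  have "poly (map_poly e f) (e x) = e (poly f x)" for f
    by (induction f) (simp_all add: map_poly_pCons e_add e_mult)
  then have "poly f x = 0"
    using assms(3) \<omega> by (metis e_eq_0_iff)
  then obtain h where h: "f = [:- x, 1:] * h"
    by (auto simp: poly_eq_0_iff_dvd dvd_def)
  then have "h \<noteq> 0"
    using assms(2) by auto
  have "is_unit [:- x, 1:] \<or> is_unit h"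
    using irreducibleD[OF assms(1) h] .
  then have "degree h = 0"
    by (auto simp: is_unit_iff_degree \<open>h \<noteq> 0\<close>)
  moreover have "degree f = degree [:- x, 1:] + degree h"
    unfolding h using \<open>h \<noteq> 0\<close> by (intro degree_mult_eq) auto
  ultimately have "degree f = 1"
    by simp
  with assms(2) show False
    by simp
qed

theorem theorem5p9:
  fixes e :: "'f::{field,finite} \<Rightarrow> 'k::{field,finite}"
    and \<beta> :: "'k^3 \<Rightarrow> 'f^9"
    and L l_inf P_inf :: "('k^3) set"
    and \<mu> :: "('f^9) set"
    and \<sigma> :: "'k^9 \<Rightarrow> 'k^9"
    and \<nu> :: "('k^9) set"
    and \<omega> :: 'k
    and B :: "'f^4^9"
  assumes "abb_setting e \<beta> L l_inf P_inf \<mu>"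
    and "generates_pointwise_stabiliser e (\<beta> ` l_inf) \<sigma>"
    and "indicator_line e (\<beta> ` l_inf) (desarguesian_spread \<beta> l_inf) \<sigma> \<nu>"
    and "abb_coordinates e \<beta> L P_inf \<mu> \<sigma> \<nu> \<omega> B"
  shows "(\<forall>c a :: 'f.
            odd CARD('f) \<and> CARD('f) mod 3 = 1 \<and>
            irreducible [:c, 0, 0, 1:] \<and> poly (map_poly e [:c, 0, 0, 1:]) \<omega> = 0 \<and>
            (\<nexists>b. a = b\<^sup>2) \<and> a \<noteq> 1 / 2 \<longrightarrow>
            (let K = plane_set \<beta> L l_inf P_inf \<mu> B
                       [[1, 0, - a, 1], [1, 0, - a, - 1],
                        [1, 1, 1 - a, 1], [1, - 1, 1 - a, 1],
                        [1, 1, 1 - a, - 1], [1, - 1, 1 - a, - 1]]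
             in higgledy_piggledy 5 2 (\<beta> ` L) K \<and> card K = 7))
       \<and> (\<forall>a :: 'f.
            even CARD('f) \<and>
            irreducible [:1, 1, 0, 1 :: 'f:] \<and> poly (map_poly e [:1, 1, 0, 1:]) \<omega> = 0 \<and>
            absolute_trace a = 1 \<and> a \<noteq> 1 \<longrightarrow>
            (let K = plane_set \<beta> L l_inf P_inf \<mu> B
                       [[1, 0, a, 1], [1, 1, a, 1],
                        [a, 0, 1, 1], [a, 1, 1, 1],
                        [1, a, a\<^sup>2, 1], [a\<^sup>2, a, 1, 1]]
             in higgledy_piggledy 5 2 (\<beta> ` L) K \<and> card K = 7))"
proof -
  interpret abb e \<beta> L l_inf P_inf \<mu> \<sigma> \<nu> \<omega> B
    using assms by unfold_locales (auto simp: abb_setting_def)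
  show ?thesis
  proof (intro conjI allI impI)
    fix c a :: 'f
    assume "odd CARD('f) \<and> CARD('f) mod 3 = 1 \<and>
      irreducible [:c, 0, 0, 1:] \<and> poly (map_poly e [:c, 0, 0, 1:]) \<omega> = 0 \<and>
      (\<nexists>b. a = b\<^sup>2) \<and> a \<noteq> 1 / 2"
    then have odd: "odd CARD('f)" and irr: "irreducible [:c, 0, 0, 1:]"
      and root: "poly (map_poly e [:c, 0, 0, 1:]) \<omega> = 0" and a: "\<nexists>b. a = b\<^sup>2" "a \<noteq> 1 / 2"
      by blast+
    let ?pts = "[[1, 0, - a, 1], [1, 0, - a, - 1], [1, 1, 1 - a, 1], [1, - 1, 1 - a, 1],
      [1, 1, 1 - a, - 1], [1, - 1, 1 - a, - 1]]"
    have two: "(2 :: 'f) \<noteq> 0"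
      using odd even_card_iff_char_two by blast
    \<comment> \<open>Separates parameters that differ by a sign when the planes are
      counted.\<close>
    then have one: "(1 :: 'f) \<noteq> - 1" "(- 1 :: 'f) \<noteq> 1"
      by (metis add.right_inverse one_add_one)+
    have \<omega>: "frob \<omega> \<noteq> \<omega>"
      by (rule root_not_frob_fixed[OF irr _ root]) simp
    have \<omega>3: "\<omega> ^ 3 + e c = 0"
      using root by (simp add: map_poly_pCons power3_eq_cube algebra_simps)
    have lineless: "only_lineless_quadrics (affine_value \<theta> ` set ?pts) \<and> card (affine_value \<theta> ` set ?pts) = 6"
      if "\<theta> \<in> {\<omega>, frob \<omega>, frob (frob \<omega>)}" for \<theta>
    proof -
      have \<theta>: "frob \<theta> \<noteq> \<theta>"
        using that \<omega> frob_neq[OF \<omega>] by auto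
      have 1: "frob \<omega> ^ 3 + e c = 0"
        using arg_cong[OF \<omega>3, of frob] by (simp add: frob_add frob_power)
      have "frob (frob \<omega>) ^ 3 + e c = 0"
        using arg_cong[OF 1, of frob] by (simp add: frob_add frob_power)
      then have \<theta>3: "\<theta> ^ 3 + e c = 0"
        using that 1 \<omega>3 by auto
      have "affine_value \<theta> ` set ?pts =
        {affine_param \<theta> 1 0 (- a), - affine_param \<theta> 1 0 (- a),
         affine_param \<theta> 1 1 (1 - a), affine_param \<theta> 1 (- 1) (1 - a),
         - affine_param \<theta> 1 1 (1 - a), - affine_param \<theta> 1 (- 1) (1 - a)}"
        by (simp add: affine_value_def e_minus)
      moreover have "card {affine_param \<theta> 1 0 (- a), - affine_param \<theta> 1 0 (- a),
         affine_param \<theta> 1 1 (1 - a), affine_param \<theta> 1 (- 1) (1 - a),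
         - affine_param \<theta> 1 1 (1 - a), - affine_param \<theta> 1 (- 1) (1 - a)} = 6"
        unfolding affine_param_minus[symmetric] using one by (simp add: affine_param_eq_iff[OF \<theta>])
      ultimately show ?thesis
        using only_lineless_quadrics_odd[OF \<theta> \<theta>3 two a] by simp
    qed
    have pts: "length X = 4 \<and> X ! 3 \<noteq> 0" if "X \<in> set ?pts" for X
      using that by auto
    show "let K = plane_set \<beta> L l_inf P_inf \<mu> B ?pts in higgledy_piggledy 5 2 (\<beta> ` L) K \<and> card K = 7"
      using higgledy_piggledy_plane_set[OF \<omega> pts _ lineless] by (simp add: Let_def)
  next
    fix a :: 'f
    assume "even CARD('f) \<and>
      irreducible [:1, 1, 0, 1 :: 'f:] \<and> poly (map_poly e [:1, 1, 0, 1:]) \<omega> = 0 \<and>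
      absolute_trace a = 1 \<and> a \<noteq> 1"
    then have even: "even CARD('f)" and irr: "irreducible [:1, 1, 0, 1 :: 'f:]"
      and root: "poly (map_poly e [:1, 1, 0, 1:]) \<omega> = 0" and a: "absolute_trace a = 1" "a \<noteq> 1"
      by blast+
    let ?pts = "[[1, 0, a, 1], [1, 1, a, 1], [a, 0, 1, 1], [a, 1, 1, 1], [1, a, a\<^sup>2, 1], [a\<^sup>2, a, 1, 1]]"
    have two: "(2 :: 'f) = 0"
      using even even_card_iff_char_two by blast
    have tr: "\<nexists>b. a = b\<^sup>2 + b"
      using a(1) absolute_trace_artin_schreier[OF two] by auto
    then have "a \<noteq> 0"
      by (metis add_0 zero_power2)
    \<comment> \<open>In characteristic two 1 is the only square root of 1; this separates
      \<open>(1, a, a^2)\<close> from \<open>(a^2, a, 1)\<close>.\<close>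
    have "a\<^sup>2 \<noteq> 1"
      using a(2) unfolding power2_eq_1_iff char_two_minus(1)[OF two] by blast
    have \<omega>: "frob \<omega> \<noteq> \<omega>"
      by (rule root_not_frob_fixed[OF irr _ root]) simp
    have \<omega>3: "\<omega> ^ 3 + \<omega> + 1 = 0"
      using root by (simp add: map_poly_pCons power3_eq_cube algebra_simps)
    have lineless: "only_lineless_quadrics (affine_value \<theta> ` set ?pts) \<and> card (affine_value \<theta> ` set ?pts) = 6"
      if "\<theta> \<in> {\<omega>, frob \<omega>, frob (frob \<omega>)}" for \<theta>
    proof -
      have \<theta>: "frob \<theta> \<noteq> \<theta>"
        using that \<omega> frob_neq[OF \<omega>] by auto
      have 1: "frob \<omega> ^ 3 + frob \<omega> + 1 = 0"
        using arg_cong[OF \<omega>3, of frob] by (simp add: frob_add frob_power)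
      have "frob (frob \<omega>) ^ 3 + frob (frob \<omega>) + 1 = 0"
        using arg_cong[OF 1, of frob] by (simp add: frob_add frob_power)
      then have \<theta>3: "\<theta> ^ 3 + \<theta> + 1 = 0"
        using that 1 \<omega>3 by auto
      have "affine_value \<theta> ` set ?pts =
        {affine_param \<theta> 1 0 a, affine_param \<theta> 1 1 a, affine_param \<theta> a 0 1, affine_param \<theta> a 1 1,
         affine_param \<theta> 1 a (a\<^sup>2), affine_param \<theta> (a\<^sup>2) a 1}"
        by (simp add: affine_value_def)
      moreover have "card {affine_param \<theta> 1 0 a, affine_param \<theta> 1 1 a, affine_param \<theta> a 0 1,
         affine_param \<theta> a 1 1, affine_param \<theta> 1 a (a\<^sup>2), affine_param \<theta> (a\<^sup>2) a 1} = 6"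
        using a(2) \<open>a \<noteq> 0\<close> \<open>a\<^sup>2 \<noteq> 1\<close> by (simp add: affine_param_eq_iff[OF \<theta>] eq_commute[of 1])
      ultimately show ?thesis
        using only_lineless_quadrics_even[OF \<theta> \<theta>3 two tr a(2)] by simp
    qed
    have pts: "length X = 4 \<and> X ! 3 \<noteq> 0" if "X \<in> set ?pts" for X
      using that by auto
    show "let K = plane_set \<beta> L l_inf P_inf \<mu> B ?pts in higgledy_piggledy 5 2 (\<beta> ` L) K \<and> card K = 7"
      using higgledy_piggledy_plane_set[OF \<omega> pts _ lineless] by (simp add: Let_def)
  qed
qed

end
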